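(* Let $-1<\nu<0$. Then $$\sum_{k \ge 1} \frac{1}{\Big[\big[(j_k^{\nu})'\big]^2 - \nu^2 \Big] \big[(j_k^{\nu})'\big]^2} = \frac{1}{4\nu^2 (\nu+1)} - \frac{1}{\Big[\big[(j_0^{\nu})'\big]^2 + \nu^2 \Big] \big[(j_0^{\nu})'\big]^2}.$$
   Context: $\{(j_n^{\nu})': n\ge1\}$ denotes the sequence of strictly positive zeros, in ascending order, of the derivative $J_\nu'$ of the Bessel function of the first kind $J_\nu$. For $-1<\nu<0$, $(j_0^{\nu})'$ denotes the unique strictly positive zero of $I_\nu'$, the derivative of the modified Bessel function of the first kind $I_\nu$. The prime in $(j_n^\nu)'$ is only notation. *)

theory Defs
  imports "HOL-Analysis.Analysis"
begin

text \<open>Bessel functions of real order, by their ascending series. They are used for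
  positive arguments only: for \<open>x \<le> 0\<close> the value of \<open>powr\<close> carries no meaning here.
  The factor \<open>rGamma\<close> is \<open>1 / Gamma\<close>, and is \<open>0\<close> at the poles of \<open>Gamma\<close>.\<close>

definition bessel_J :: "real \<Rightarrow> real \<Rightarrow> real" where
  "bessel_J \<nu> x =
     (x / 2) powr \<nu> * (\<Sum>m. (-1) ^ m * rGamma (real m + \<nu> + 1) / fact m * (x / 2) ^ (2 * m))"

definition bessel_I :: "real \<Rightarrow> real \<Rightarrow> real" where
  "bessel_I \<nu> x =
     (x / 2) powr \<nu> * (\<Sum>m. rGamma (real m + \<nu> + 1) / fact m * (x / 2) ^ (2 * m))"

definition bessel_J_deriv_zeros :: "real \<Rightarrow> real set" where
  "bessel_J_deriv_zeros \<nu> = {x. x > 0 \<and> deriv (bessel_J \<nu>) x = 0}"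

text \<open>The \<open>n\<close>-th positive zero in ascending order, for \<open>n \<ge> 1\<close>: the zero with exactly \<open>n\<close>
  zeros up to and including itself. As \<open>card\<close> is \<open>0\<close> on infinite sets, \<open>n \<ge> 1\<close> forces the
  set to be finite.\<close>

definition bessel_J_deriv_zero :: "real \<Rightarrow> nat \<Rightarrow> real" where
  "bessel_J_deriv_zero \<nu> n =
     (THE x. x \<in> bessel_J_deriv_zeros \<nu> \<and> card {y \<in> bessel_J_deriv_zeros \<nu>. y \<le> x} = n)"

definition bessel_I_deriv_zero :: "real \<Rightarrow> real" where
  "bessel_I_deriv_zero \<nu> = (THE x. x > 0 \<and> deriv (bessel_I \<nu>) x = 0)"

end

theory Submission
  imports Defs "HOL-Real_Asymp.Real_Asymp"
begin

text \<open>
  Put \<open>s = x\<^sup>2\<close>. Up to the factor \<open>(x / 2) powr \<nu> / x\<close>, the derivative of \<open>bessel_J \<nu>\<close> at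
  \<open>x > 0\<close> is an entire function \<open>G\<close> of \<open>s\<close> (called \<open>dbessel \<nu>\<close> below), and that of \<open>bessel_I \<nu>\<close>
  is \<open>G\<close> at \<open>- x\<^sup>2\<close>. The numbers to be summed are therefore the values of
  \<open>f z = 1 / ((z - \<nu>\<^sup>2) * z)\<close> at the zeros of \<open>G\<close>: the positive zeros are the squares of the
  zeros of the derivative of \<open>bessel_J \<nu>\<close>, and the only negative zero comes from
  \<open>bessel_I \<nu>\<close>. The claim is that the sum of \<open>f\<close> over all zeros of \<open>G\<close> is
  \<open>1 / (4 * \<nu>\<^sup>2 * (\<nu> + 1))\<close>.

  If \<open>G\<close> were a polynomial with real simple zeros \<open>z\<close>, then \<open>G' s / G s\<close> would be the sum of
  the \<open>1 / (s - z)\<close>, and the decomposition \<open>f z = (1 / (z - \<nu>\<^sup>2) - 1 / z) / \<nu>\<^sup>2\<close> would express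
  the sum by the logarithmic derivatives of \<open>G\<close> at \<open>\<nu>\<^sup>2\<close> and at \<open>0\<close>. The second is read off the
  power series. The first follows from Bessel's equation, which in the form \<open>dbessel_ode\<close>
  degenerates at \<open>s = \<nu>\<^sup>2\<close> to a relation between \<open>G\<close> and \<open>G'\<close> alone.

  To make this rigorous, \<open>G\<close> is approximated by polynomials \<open>P n\<close> built from Laguerre
  polynomials rescaled by \<open>4 * n\<close>. They are real-rooted: Rodrigues' formula and Rolle's theorem
  give \<open>n\<close> positive roots of the Laguerre polynomial, and one more application of Rolle's theorem
  gives \<open>n - 1\<close> positive roots of \<open>P n\<close>; the remaining root is negative (\<open>roots_of_approx\<close>). So
  the polynomial argument applies to \<open>P n\<close> (\<open>sum_over_roots_limit\<close>). Two facts allow the passage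
  to the limit. On a bounded interval the roots of \<open>P n\<close> converge one by one to the zeros of \<open>G\<close>,
  because these are simple (\<open>sum_over_roots_tendsto\<close>). And the sums of \<open>1 / \<bar>r\<bar>\<close> over the
  roots of \<open>P n\<close> are bounded uniformly in \<open>n\<close>, so roots with \<open>\<bar>r\<bar> > R\<close> contribute only
  \<open>O(1 / R)\<close> to the sum of \<open>f\<close>.

  What is needed about \<open>G\<close> itself comes from the differential equation: its zeros are simple
  (\<open>dbessel_simple_zeros\<close>, by a monotone energy), infinitely many are positive
  (\<open>dbessel_zeros_unbounded\<close>, by oscillation), none lies in \<open>[0, \<nu>\<^sup>2]\<close> (\<open>dbessel_neg\<close>), and
  exactly one is negative (\<open>dbessel_neg_zero\<close>).
\<close>

section \<open>Zeros of real functions\<close>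

lemma nonvanishing_sign:
  fixes f :: "real \<Rightarrow> real"
  assumes "connected S" "continuous_on S f" "\<And>x. x \<in> S \<Longrightarrow> f x \<noteq> 0"
  shows "(\<forall>x\<in>S. f x > 0) \<or> (\<forall>x\<in>S. f x < 0)"
proof (rule ccontr)
  assume "\<not> ?thesis"
  then obtain x y where "x \<in> S" "y \<in> S" "f x \<le> 0" "f y \<ge> 0" by (auto simp: not_less)
  moreover have "connected (f ` S)"
    by (rule connected_continuous_image) (use assms in auto)
  ultimately have "0 \<in> f ` S" by (meson connected_iff_interval image_eqI)
  with assms(3) show False by auto
qed

text \<open>The new zeros lie strictly between the extreme points of \<open>S\<close>; hence they stay distinct from any
  further zero that is found beyond \<open>Max S\<close>.\<close>

lemma rolle_many:
  fixes f f' :: "real \<Rightarrow> real"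
  assumes "finite S" "card S = Suc k" "S \<subseteq> {a..}" "\<And>x. x \<in> S \<Longrightarrow> f x = 0"
    and cont: "continuous_on {a..} f"
    and der: "\<And>x. x > a \<Longrightarrow> (f has_real_derivative f' x) (at x)"
  shows "\<exists>T. finite T \<and> card T = k \<and> T \<subseteq> {Min S<..<Max S} \<and> (\<forall>x\<in>T. f' x = 0)"
  using assms(1-4)
proof (induction k arbitrary: S)
  case 0
  then show ?case by (intro exI[of _ "{}"]) auto
next
  case (Suc k)
  define S' where "S' = S - {Max S}"
  have "S \<noteq> {}" using Suc.prems by auto
  then have M: "Max S \<in> S" using Suc.prems by auto
  have S': "finite S'" "card S' = Suc k" "S' \<subseteq> S"
    using Suc.prems M by (auto simp: S'_def)
  have "S' \<noteq> {}" using S' by auto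
  then have m: "Max S' \<in> S'" "Min S' \<in> S'" using S' by auto
  obtain T where T: "finite T" "card T = k" "T \<subseteq> {Min S'<..<Max S'}" "\<forall>x\<in>T. f' x = 0"
    using Suc.IH[of S'] S' Suc.prems(3,4) by blast
  have lt: "Max S' < Max S"
    using m S' Suc.prems(1) by (metis Max_ge S'_def Diff_iff insertI1 order_le_imp_less_or_eq)
  have min: "Min S \<le> Min S'" using m S' Suc.prems(1) by auto
  have "a \<le> Max S'" using m S'(3) Suc.prems(3) by auto
  have "\<exists>z. Max S' < z \<and> z < Max S \<and> (*) (f' z) = (\<lambda>v. 0)"
  proof (rule Rolle_deriv[of _ _ f])
    show "f (Max S') = f (Max S)" using Suc.prems(4) m S'(3) M by auto
    show "continuous_on {Max S'..Max S} f"
      by (rule continuous_on_subset[OF cont]) (use \<open>a \<le> Max S'\<close> in auto)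
  qed (use lt \<open>a \<le> Max S'\<close> der in \<open>auto simp: has_field_derivative_def\<close>)
  then obtain z where z: "Max S' < z" "z < Max S" "f' z = 0"
    by (metis mult.right_neutral)
  show ?case
  proof (intro exI[of _ "insert z T"] conjI)
    have "Min S' \<le> Max S'" using m S' by auto
    then show "insert z T \<subseteq> {Min S<..<Max S}" using z T(3) lt min by fastforce
    show "card (insert z T) = Suc k" using T z by (subst card_insert_disjoint) auto
  qed (use T z in auto)
qed

text \<open>Rolle's theorem for an interval whose right end is infinity: if \<open>f'\<close> had no zero, \<open>f\<close> would be
  strictly monotone and its limit would differ from \<open>f m\<close>.\<close>

lemma rolle_at_infinity:
  fixes f f' :: "real \<Rightarrow> real"
  assumes "f m = 0" "(f \<longlongrightarrow> 0) at_top"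
    and der: "\<And>x. x \<ge> m \<Longrightarrow> (f has_real_derivative f' x) (at x)"
    and cont: "continuous_on {m..} f'"
  shows "\<exists>x>m. f' x = 0"
proof (rule ccontr)
  assume "\<not> ?thesis"
  then have nz: "\<And>x. x > m \<Longrightarrow> f' x \<noteq> 0" by auto
  have sgn: "(\<forall>x>m. f' x > 0) \<or> (\<forall>x>m. f' x < 0)"
  proof -
    have "(\<forall>x\<in>{m<..}. f' x > 0) \<or> (\<forall>x\<in>{m<..}. f' x < 0)"
      by (rule nonvanishing_sign) (use nz in \<open>auto intro: continuous_on_subset[OF cont]\<close>)
    then show ?thesis by auto
  qed
  have c: "continuous_on {m..y} f" for y
    by (rule DERIV_continuous_on[of _ _ f']) (auto intro: has_field_derivative_at_within der)
  from sgn show False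
  proof
    assume p: "\<forall>x>m. f' x > 0"
    have inc: "f x < f y" if "m \<le> x" "x < y" for x y
      by (rule DERIV_pos_imp_increasing_open[OF that(2)])
        (meson that p der le_less_trans less_imp_le, rule continuous_on_subset[OF c[of y]], use that in auto)
    have "f (m+1) > 0" using inc[of m "m+1"] assms(1) by auto
    moreover have "f (m+1) \<le> 0"
      by (rule tendsto_lowerbound[OF assms(2)])
        (auto intro!: eventually_mono[OF eventually_gt_at_top[of "m+1"]] less_imp_le inc)
    ultimately show False by auto
  next
    assume p: "\<forall>x>m. f' x < 0"
    have inc: "f x > f y" if "m \<le> x" "x < y" for x y
      by (rule DERIV_neg_imp_decreasing_open[OF that(2)])
        (meson that p der le_less_trans less_imp_le, rule continuous_on_subset[OF c[of y]], use that in auto)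
    have "f (m+1) < 0" using inc[of m "m+1"] assms(1) by auto
    moreover have "f (m+1) \<ge> 0"
      by (rule tendsto_upperbound[OF assms(2)])
        (auto intro!: eventually_mono[OF eventually_gt_at_top[of "m+1"]] less_imp_le inc)
    ultimately show False by auto
  qed
qed

section \<open>Convergence of zeros\<close>

lemma uniform_limit_nonvanishing:
  fixes g :: "real \<Rightarrow> real"
  assumes lim: "uniform_limit K p g sequentially" and K: "compact K" and cont: "continuous_on K g"
    and nz: "\<And>x. x \<in> K \<Longrightarrow> g x \<noteq> 0"
  shows "\<forall>\<^sub>F n in sequentially. \<forall>x\<in>K. p n x \<noteq> 0"
proof (cases "K = {}")
  case False
  obtain x0 where x0: "x0 \<in> K" "\<forall>x\<in>K. \<bar>g x0\<bar> \<le> \<bar>g x\<bar>"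
    using continuous_attains_inf[OF K False, of "\<lambda>x. \<bar>g x\<bar>"] cont by (auto intro: continuous_intros)
  have "\<bar>g x0\<bar> > 0" using nz x0 by auto
  from uniform_limitD[OF lim this] show ?thesis
  proof eventually_elim
    case (elim n)
    then show ?case using x0(2) by (fastforce simp: dist_real_def)
  qed
qed auto

text \<open>At a zero with nonvanishing derivative \<open>g\<close> changes sign, and pointwise convergence at the two
  points \<open>z - d\<close> and \<open>z + d\<close> passes this sign change on to \<open>p n\<close>.\<close>

lemma root_eventually_near:
  fixes g g' :: "real \<Rightarrow> real"
  assumes e: "e > 0" and gz: "g z = 0"
    and der: "\<And>x. x \<in> cball z e \<Longrightarrow> (g has_real_derivative g' x) (at x)"
    and g': "continuous_on (cball z e) g'" "\<And>x. x \<in> cball z e \<Longrightarrow> g' x \<noteq> 0"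
    and p: "\<And>x. x \<in> cball z e \<Longrightarrow> (\<lambda>n. p n x) \<longlonglongrightarrow> g x" "\<And>n. continuous_on (cball z e) (p n)"
    and d: "0 < d" "d \<le> e"
  shows "\<forall>\<^sub>F n in sequentially. \<exists>r. \<bar>r - z\<bar> \<le> d \<and> p n r = 0"
proof -
  have cb: "cball z e = {z - e..z + e}" by (auto simp: cball_def dist_real_def)
  have sgn: "(\<forall>x\<in>cball z e. g' x > 0) \<or> (\<forall>x\<in>cball z e. g' x < 0)"
    by (rule nonvanishing_sign) (use g' in \<open>auto simp: convex_connected\<close>)
  have in_e: "z - d \<in> cball z e" "z + d \<in> cball z e" using d by (auto simp: cb)
  have contp: "continuous_on {z - d..z + d} (p n)" for n
    by (rule continuous_on_subset[OF p(2)]) (use d in \<open>auto simp: cb\<close>)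
  have mid: "x \<in> cball z e" if "z - d \<le> x \<and> x \<le> z \<or> z \<le> x \<and> x \<le> z + d" for x
    using that d by (auto simp: cb)
  from sgn show ?thesis
  proof
    assume s: "\<forall>x\<in>cball z e. g' x > 0"
    have "g (z - d) < g z"
      by (rule DERIV_pos_imp_increasing[of _ _ g], use d in simp) (meson s der mid atLeastAtMost_iff)
    moreover have "g z < g (z + d)"
      by (rule DERIV_pos_imp_increasing[of _ _ g], use d in simp) (meson s der mid atLeastAtMost_iff)
    ultimately have lt: "g (z - d) < 0" "0 < g (z + d)" using gz by auto
    have "\<forall>\<^sub>F n in sequentially. p n (z - d) < 0 \<and> 0 < p n (z + d)"
      using order_tendstoD(2)[OF p(1)[OF in_e(1)] lt(1)] order_tendstoD(1)[OF p(1)[OF in_e(2)] lt(2)]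
      by eventually_elim auto
    then show ?thesis
    proof eventually_elim
      case (elim n)
      then obtain x where "z - d \<le> x" "x \<le> z + d" "p n x = 0"
        using IVT'[of "p n" "z - d" 0 "z + d"] contp[of n] d by auto
      then show ?case by (intro exI[of _ x]) auto
    qed
  next
    assume s: "\<forall>x\<in>cball z e. g' x < 0"
    have "g (z - d) > g z"
      by (rule DERIV_neg_imp_decreasing[of _ _ g], use d in simp) (meson s der mid atLeastAtMost_iff)
    moreover have "g z > g (z + d)"
      by (rule DERIV_neg_imp_decreasing[of _ _ g], use d in simp) (meson s der mid atLeastAtMost_iff)
    ultimately have lt: "g (z - d) > 0" "0 > g (z + d)" using gz by auto
    have "\<forall>\<^sub>F n in sequentially. p n (z - d) > 0 \<and> 0 > p n (z + d)"
      using order_tendstoD(1)[OF p(1)[OF in_e(1)] lt(1)] order_tendstoD(2)[OF p(1)[OF in_e(2)] lt(2)]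
      by eventually_elim auto
    then show ?thesis
    proof eventually_elim
      case (elim n)
      then obtain x where "z - d \<le> x" "x \<le> z + d" "p n x = 0"
        using IVT2'[of "p n" "z + d" 0 "z - d"] contp[of n] d by auto
      then show ?case by (intro exI[of _ x]) auto
    qed
  qed
qed

lemma root_unique:
  fixes p p' :: "real \<Rightarrow> real"
  assumes der: "\<And>x. (p has_real_derivative p' x) (at x)"
    and nz: "\<forall>x\<in>cball z e. p' x \<noteq> 0"
    and "x \<in> ball z e" "y \<in> ball z e" "p x = 0" "p y = 0"
  shows "x = y"
proof -
  have contp: "continuous_on A (p)" for A
    by (rule DERIV_continuous_on[of _ _ "p'"]) (auto intro: has_field_derivative_at_within der)
  have *: False if "x < y" "p x = 0" "p y = 0" "x \<in> ball z e" "y \<in> ball z e" for x y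
  proof -
    have "\<exists>w. x < w \<and> w < y \<and> (*) (p' w) = (\<lambda>v. 0)"
      by (rule Rolle_deriv[of _ _ "p"])
        (use that contp der in \<open>auto simp: has_field_derivative_def\<close>)
    then obtain w where w: "x < w" "w < y" "p' w = 0" by (metis mult.right_neutral)
    then have "w \<in> cball z e" using that by (auto simp: dist_real_def)
    with w nz show False by auto
  qed
  show ?thesis using *[of x y] *[of y x] assms by (meson linorder_neqE)
qed

text \<open>Near a simple zero \<open>z\<close> the function \<open>p n\<close> eventually has exactly one root: existence is the sign
  change, uniqueness is Rolle's theorem together with uniform convergence of the derivatives. The
  sum therefore has a single summand.\<close>

lemma sum_over_root_near:
  fixes g g' f :: "real \<Rightarrow> real"
  assumes e: "e > 0" and gz: "g z = 0"
    and der: "\<And>x. x \<in> cball z e \<Longrightarrow> (g has_real_derivative g' x) (at x)"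
    and g': "continuous_on (cball z e) g'" "\<And>x. x \<in> cball z e \<Longrightarrow> g' x \<noteq> 0"
    and p: "\<And>x. x \<in> cball z e \<Longrightarrow> (\<lambda>n. p n x) \<longlonglongrightarrow> g x"
    and derp: "\<And>n x. (p n has_real_derivative p' n x) (at x)"
    and p': "uniform_limit (cball z e) p' g' sequentially"
    and f: "isCont f z"
  shows "(\<lambda>n. \<Sum>r | r \<in> ball z e \<and> p n r = 0. f r) \<longlonglongrightarrow> f z"
proof (rule tendstoI)
  fix \<epsilon> :: real assume "\<epsilon> > 0"
  then obtain d where d: "d > 0" "\<And>r. dist r z < d \<Longrightarrow> dist (f r) (f z) < \<epsilon>"
    using f unfolding continuous_at_eps_delta by blast
  define \<delta> where "\<delta> = min d e / 2"
  have \<delta>: "0 < \<delta>" "\<delta> < d" "\<delta> < e" using d e by (auto simp: \<delta>_def)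
  have contp: "continuous_on A (p n)" for A n
    by (rule DERIV_continuous_on[of _ _ "p' n"]) (auto intro: has_field_derivative_at_within derp)
  have "\<forall>\<^sub>F n in sequentially. \<exists>r. \<bar>r - z\<bar> \<le> \<delta> \<and> p n r = 0"
    by (rule root_eventually_near[OF e gz der g' p contp]) (use \<delta> in auto)
  moreover have "\<forall>\<^sub>F n in sequentially. \<forall>x\<in>cball z e. p' n x \<noteq> 0"
    by (rule uniform_limit_nonvanishing[OF p' _ g']) auto
  ultimately show "\<forall>\<^sub>F n in sequentially. dist (\<Sum>r | r \<in> ball z e \<and> p n r = 0. f r) (f z) < \<epsilon>"
  proof eventually_elim
    case (elim n)
    then obtain r where r: "\<bar>r - z\<bar> \<le> \<delta>" "p n r = 0" by auto
    have uniq: "r' = r" if "r' \<in> ball z e" "p n r' = 0" for r'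
      using root_unique[of "p n" "p' n" z e, OF derp] that r \<delta> elim
      by (auto simp: dist_real_def)
    have "r \<in> ball z e" using r \<delta> by (auto simp: dist_real_def)
    with r(2) have "{r. r \<in> ball z e \<and> p n r = 0} = {r}" using uniq by blast
    moreover have "dist (f r) (f z) < \<epsilon>" using r \<delta> by (intro d) (auto simp: dist_real_def)
    ultimately show ?case by simp
  qed
qed

text \<open>A real-variable counterpart of Hurwitz's theorem. Simplicity of the zeros excludes that roots of
  \<open>p n\<close> merge or become complex in the limit, and \<open>g \<noteq> 0\<close> at the ends excludes that they enter or
  leave the interval.\<close>

lemma sum_over_roots_tendsto:
  fixes g g' f :: "real \<Rightarrow> real"
  assumes der: "\<And>x. (g has_real_derivative g' x) (at x)" and g': "continuous_on UNIV g'"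
    and derp: "\<And>n x. (p n has_real_derivative p' n x) (at x)"
    and p: "uniform_limit {a..b} p g sequentially"
    and p': "uniform_limit {a..b} p' g' sequentially"
    and Z: "Z = {z \<in> {a..b}. g z = 0}" "finite Z"
    and ends: "g a \<noteq> 0" "g b \<noteq> 0"
    and simple: "\<And>z. z \<in> Z \<Longrightarrow> g' z \<noteq> 0"
    and f: "\<And>z. z \<in> Z \<Longrightarrow> isCont f z"
  shows "(\<lambda>n. \<Sum>r | r \<in> {a..b} \<and> p n r = 0. f r) \<longlonglongrightarrow> (\<Sum>z\<in>Z. f z)"
proof -
  have contg: "continuous_on A g" for A
    by (rule DERIV_continuous_on[of _ _ g']) (auto intro: has_field_derivative_at_within der)
  have "\<exists>e>0. cball z e \<subseteq> {a..b} \<and> (\<forall>x\<in>cball z e. g' x \<noteq> 0) \<and> (\<forall>y\<in>Z. y \<noteq> z \<longrightarrow> 2 * e < \<bar>y - z\<bar>)"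
    if z: "z \<in> Z" for z
  proof -
    have "z \<in> {a<..<b}" using z ends Z by (auto simp: order_le_less)
    then obtain e1 where e1: "e1 > 0" "cball z e1 \<subseteq> {a<..<b}"
      using open_contains_cball[of "{a<..<b}"] open_greaterThanLessThan by blast
    have "open {x. g' x \<noteq> 0}"
      using open_Collect_neq[OF g' continuous_on_const[of UNIV 0]] .
    then obtain e2 where e2: "e2 > 0" "cball z e2 \<subseteq> {x. g' x \<noteq> 0}"
      using open_contains_cball[of "{x. g' x \<noteq> 0}"] simple[OF z] by blast
    obtain e3 where e3: "e3 > 0" "\<forall>y\<in>Z. y \<noteq> z \<longrightarrow> e3 \<le> dist z y"
      using finite_set_avoid[OF Z(2), of z] by auto
    define e where "e = min e1 (min e2 (e3 / 3))"
    have "e > 0" "e \<le> e1" "e \<le> e2" "2 * e < e3" using e1 e2 e3 by (auto simp: e_def)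
    moreover have "cball z e \<subseteq> cball z e1" "cball z e \<subseteq> cball z e2"
      using calculation by (auto intro: subset_cball)
    moreover have "2 * e < \<bar>y - z\<bar>" if "y \<in> Z" "y \<noteq> z" for y
    proof -
      have "e3 \<le> \<bar>z - y\<bar>" using e3 that by (auto simp: dist_real_def)
      then show ?thesis using \<open>2 * e < e3\<close> by linarith
    qed
    moreover have "{a<..<b} \<subseteq> {a..b}" by auto
    ultimately have "0 < e" "cball z e \<subseteq> {a..b}" "\<forall>x\<in>cball z e. g' x \<noteq> 0"
      "\<forall>y\<in>Z. y \<noteq> z \<longrightarrow> 2 * e < \<bar>y - z\<bar>"
      using e1(2) e2(2) by blast+
    then show ?thesis by blast
  qed
  then obtain e where e: "\<And>z. z \<in> Z \<Longrightarrow> e z > 0" "\<And>z. z \<in> Z \<Longrightarrow> cball z (e z) \<subseteq> {a..b}"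
    "\<And>z x. z \<in> Z \<Longrightarrow> x \<in> cball z (e z) \<Longrightarrow> g' x \<noteq> 0"
    "\<And>z y. z \<in> Z \<Longrightarrow> y \<in> Z \<Longrightarrow> y \<noteq> z \<Longrightarrow> 2 * e z < \<bar>y - z\<bar>"
    by metis
  have "(\<lambda>n. \<Sum>z\<in>Z. \<Sum>r | r \<in> ball z (e z) \<and> p n r = 0. f r) \<longlonglongrightarrow> (\<Sum>z\<in>Z. f z)"
  proof (rule tendsto_sum)
    fix z assume z: "z \<in> Z"
    show "(\<lambda>n. \<Sum>r | r \<in> ball z (e z) \<and> p n r = 0. f r) \<longlonglongrightarrow> f z"
    proof (rule sum_over_root_near)
      show "uniform_limit (cball z (e z)) p' g' sequentially"
        using e(2)[OF z] p' by (rule uniform_limit_on_subset[rotated])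
      show "(\<lambda>n. p n x) \<longlonglongrightarrow> g x" if "x \<in> cball z (e z)" for x
        by (rule tendsto_uniform_limitI[OF p]) (use that e(2)[OF z] in auto)
      show "continuous_on (cball z (e z)) g'" by (rule continuous_on_subset[OF g']) auto
    qed (use z e f derp der Z in auto)
  qed
  moreover have "\<forall>\<^sub>F n in sequentially. (\<Sum>z\<in>Z. \<Sum>r | r \<in> ball z (e z) \<and> p n r = 0. f r)
      = (\<Sum>r | r \<in> {a..b} \<and> p n r = 0. f r)"
  proof -
    define K where "K = {a..b} - (\<Union>z\<in>Z. ball z (e z))"
    have K: "compact K" unfolding K_def by (intro compact_diff) auto
    have "\<forall>\<^sub>F n in sequentially. \<forall>x\<in>K. p n x \<noteq> 0"
    proof (rule uniform_limit_nonvanishing[OF _ K contg])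
      show "uniform_limit K p g sequentially"
        by (rule uniform_limit_on_subset[OF p]) (auto simp: K_def)
      show "g x \<noteq> 0" if "x \<in> K" for x
        using that e(1)[of x] by (auto simp: K_def Z)
    qed
    moreover have "\<forall>\<^sub>F n in sequentially. \<forall>z\<in>Z. \<forall>x\<in>cball z (e z). p' n x \<noteq> 0"
    proof (rule eventually_ball_finite[OF Z(2)], rule ballI, rule uniform_limit_nonvanishing)
      fix z assume z: "z \<in> Z"
      show "uniform_limit (cball z (e z)) p' g' sequentially"
        using e(2)[OF z] p' by (rule uniform_limit_on_subset[rotated])
      show "continuous_on (cball z (e z)) g'" by (rule continuous_on_subset[OF g']) auto
    qed (use e in auto)
    ultimately show ?thesis
    proof eventually_elim
      case (elim n)
      have contp: "continuous_on A (p n)" for A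
        by (rule DERIV_continuous_on[of _ _ "p' n"]) (auto intro: has_field_derivative_at_within derp)
      have fin: "finite {r. r \<in> ball z (e z) \<and> p n r = 0}" if z: "z \<in> Z" for z
      proof -
        have "\<exists>y. {r. r \<in> ball z (e z) \<and> p n r = 0} \<subseteq> {y}"
        proof (cases "\<exists>y. y \<in> ball z (e z) \<and> p n y = 0")
          case True
          then obtain y where "y \<in> ball z (e z)" "p n y = 0" by blast
          then have "{r. r \<in> ball z (e z) \<and> p n r = 0} \<subseteq> {y}"
            using root_unique[of "p n" "p' n" z "e z", OF derp] z elim by auto
          then show ?thesis by blast
        qed auto
        then show ?thesis by (meson finite.emptyI finite.insertI finite_subset)
      qed
      have "{r. r \<in> {a..b} \<and> p n r = 0} = (\<Union>z\<in>Z. {r. r \<in> ball z (e z) \<and> p n r = 0})"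
      proof -
        have "r \<in> {a..b}" if "z \<in> Z" "r \<in> ball z (e z)" for z r
          using e(2)[OF that(1)] that(2) ball_subset_cball by blast
        moreover have "\<exists>z\<in>Z. r \<in> ball z (e z)" if "r \<in> {a..b}" "p n r = 0" for r
          using elim(1) that by (auto simp: K_def)
        ultimately show ?thesis by blast
      qed
      moreover have "(\<Sum>r\<in>(\<Union>z\<in>Z. {r. r \<in> ball z (e z) \<and> p n r = 0}). f r)
          = (\<Sum>z\<in>Z. \<Sum>r | r \<in> ball z (e z) \<and> p n r = 0. f r)"
      proof (rule sum.UNION_disjoint[OF Z(2)])
        show "\<forall>z\<in>Z. \<forall>y\<in>Z. z \<noteq> y \<longrightarrow>
          {r. r \<in> ball z (e z) \<and> p n r = 0} \<inter> {r. r \<in> ball y (e y) \<and> p n r = 0} = {}"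
        proof (intro ballI impI)
          fix z y assume "z \<in> Z" "y \<in> Z" "z \<noteq> y"
          then have "2 * e z < \<bar>y - z\<bar>" "2 * e y < \<bar>z - y\<bar>" using e(4) by auto
          then show "{r. r \<in> ball z (e z) \<and> p n r = 0} \<inter> {r. r \<in> ball y (e y) \<and> p n r = 0} = {}"
            by (auto simp: dist_real_def)
        qed
      qed (use fin in auto)
      ultimately show ?case by simp
    qed
  qed
  ultimately show ?thesis by (rule Lim_transform_eventually)
qed

section \<open>Real-rooted polynomials\<close>

lemma poly_log_deriv:
  fixes p :: "real poly"
  assumes "finite R" "card R = degree p" "p \<noteq> 0" "\<And>r. r \<in> R \<Longrightarrow> poly p r = 0" "poly p x \<noteq> 0"
  shows "poly (pderiv p) x / poly p x = (\<Sum>r\<in>R. 1 / (x - r))"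
  using assms
proof (induction R arbitrary: p rule: finite_induct)
  case empty
  then have "pderiv p = 0" by (simp add: pderiv_eq_0_iff)
  then show ?case by simp
next
  case (insert r R)
  then have "poly p r = 0" by auto
  then obtain q where q: "p = [:-r, 1:] * q" by (auto simp: poly_eq_0_iff_dvd)
  have "q \<noteq> 0" using insert q by auto
  have deg: "degree p = Suc (degree q)"
    unfolding q using \<open>q \<noteq> 0\<close> by (subst degree_mult_eq) auto
  have x: "x \<noteq> r" "poly q x \<noteq> 0" using insert.prems q by auto
  have "poly q s = 0" if "s \<in> R" for s
  proof -
    have "poly p s = 0" "s \<noteq> r" using insert that by auto
    then show ?thesis by (auto simp: q)
  qed
  then have IH: "poly (pderiv q) x / poly q x = (\<Sum>r\<in>R. 1 / (x - r))"
    using insert \<open>q \<noteq> 0\<close> deg x by (intro insert.IH) auto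
  have "poly (pderiv p) x / poly p x = 1 / (x - r) + poly (pderiv q) x / poly q x"
    unfolding q using x by (subst pderiv_mult) (simp add: pderiv_pCons field_simps)
  then show ?case using IH insert.hyps by simp
qed

text \<open>These are the generalized Laguerre polynomials \<open>L\<^sub>n\<^sup>a\<close> multiplied by \<open>n! / \<Gamma>(n + a + 1)\<close>. In this
  normalization the coefficient of \<open>(t / n) ^ m\<close> converges as \<open>n\<close> tends to infinity, to a coefficient of
  a Bessel series.\<close>

definition laguerre :: "nat \<Rightarrow> real \<Rightarrow> real poly" where
  "laguerre n a = Abs_poly (\<lambda>m. (- 1) ^ m * real (n choose m) * rGamma (real m + a + 1))"

lemma coeff_laguerre:
  "coeff (laguerre n a) m = (- 1) ^ m * real (n choose m) * rGamma (real m + a + 1)"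
  unfolding laguerre_def by (subst coeff_Abs_poly[of n]) (auto simp: binomial_eq_0)

lemma rGamma_pos: "(x::real) > 0 \<Longrightarrow> rGamma x > 0"
  by (simp add: rGamma_inverse_Gamma Gamma_real_pos)

lemma degree_laguerre: "a > -1 \<Longrightarrow> degree (laguerre n a) = n"
proof (rule antisym)
  show "degree (laguerre n a) \<le> n" by (rule degree_le) (auto simp: coeff_laguerre)
  assume "a > -1"
  then show "n \<le> degree (laguerre n a)"
    using rGamma_pos[of "real n + a + 1"] by (intro le_degree) (auto simp: coeff_laguerre)
qed

text \<open>One step of Rodrigues' formula: the derivative of \<open>exp (- t) * t powr (a + 1) * laguerre n (a + 1) t\<close>
  is \<open>exp (- t) * t powr a * laguerre (Suc n) a t\<close>.\<close>

lemma laguerre_Suc: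
  "laguerre (Suc n) a =
     pCons 0 (pderiv (laguerre n (a + 1))) + [:a + 1, -1:] * laguerre n (a + 1)"
proof (rule poly_eqI)
  fix m
  show "coeff (laguerre (Suc n) a) m =
    coeff (pCons 0 (pderiv (laguerre n (a + 1))) + [:a + 1, -1:] * laguerre n (a + 1)) m"
  proof (cases m)
    case 0
    then show ?thesis using rGamma_plus1[of "a+1"] by (simp add: coeff_laguerre algebra_simps)
  next
    case (Suc k)
    have "rGamma (a + (real k + 2)) = (a + (real k + 2)) * rGamma (a + (real k + 3))"
      using rGamma_plus1[of "a+real k + 2"] by (simp add: algebra_simps)
    then show ?thesis
      by (simp add: Suc coeff_laguerre coeff_pderiv) (simp add: algebra_simps)
  qed
qed

text \<open>The function differentiated in Rodrigues' formula vanishes at the \<open>n\<close> roots of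
  \<open>laguerre n (a + 1)\<close>, at \<open>0\<close> and at infinity, so its derivative has \<open>n + 1\<close> zeros. The
  induction changes the parameter \<open>a\<close>.\<close>

lemma laguerre_roots:
  assumes "a > -1"
  shows "\<exists>S. finite S \<and> card S = n \<and> S \<subseteq> {0<..} \<and> (\<forall>t\<in>S. poly (laguerre n a) t = 0)"
  using assms
proof (induction n arbitrary: a)
  case 0
  then show ?case by auto
next
  case (Suc n)
  obtain S where S: "finite S" "card S = n" "S \<subseteq> {0<..}"
    "\<forall>t\<in>S. poly (laguerre n (a+1)) t = 0"
    using Suc.IH[of "a+1"] Suc.prems by auto
  define f where "f = (\<lambda>t. exp (- t) * t powr (a + 1) * poly (laguerre n (a+1)) t)"
  define f' where "f' = (\<lambda>t. exp (- t) * t powr a * poly (laguerre (Suc n) a) t)"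
  have der: "(f has_real_derivative f' t) (at t)" if "t > 0" for t
  proof -
    have "(f has_real_derivative (exp (-t) * ((a + 1) * t powr a) - exp (-t) * t powr (a+1))
        * poly (laguerre n (a+1)) t + exp (-t) * t powr (a+1) * poly (pderiv (laguerre n (a+1))) t) (at t)"
      unfolding f_def using that
      by (auto intro!: derivative_eq_intros simp: algebra_simps)
    moreover have "t powr (a+1) = t * t powr a" using that by (simp add: powr_add)
    ultimately show ?thesis
      by (simp add: f'_def laguerre_Suc algebra_simps)
  qed
  have cont: "continuous_on {0..} f"
    unfolding f_def using Suc.prems by (intro continuous_intros continuous_on_powr') auto
  \<comment> \<open>Since \<open>a + 1 > 0\<close>, also \<open>0\<close> is a zero of \<open>f\<close>.\<close>
  define S0 where "S0 = insert 0 S"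
  have S0: "finite S0" "card S0 = Suc n" "S0 \<subseteq> {0..}" "\<And>x. x \<in> S0 \<Longrightarrow> f x = 0"
  proof -
    show "finite S0" "S0 \<subseteq> {0..}" using S(1,3) by (force simp: S0_def)+
    have "0 \<notin> S" using S(3) by auto
    then show "card S0 = Suc n" using S(1,2) by (simp add: S0_def)
    show "f x = 0" if "x \<in> S0" for x using that S(4) by (auto simp: S0_def f_def)
  qed
  obtain T where T: "finite T" "card T = n" "T \<subseteq> {Min S0<..<Max S0}" "\<forall>x\<in>T. f' x = 0"
    using rolle_many[OF S0 cont der] by blast
  have "Min S0 = 0" using S by (auto simp: S0_def intro!: Min_eqI)
  define M where "M = Max S0"
  have M: "M \<in> S0" unfolding M_def using S0(1) by (intro Max_in) (auto simp: S0_def)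
  have "M \<ge> 0" using M S0 by auto
  have lim: "(f \<longlongrightarrow> 0) at_top"
  proof -
    have mono: "((\<lambda>t. exp (- t) * t powr (a + 1) * t ^ i) \<longlongrightarrow> 0) at_top" for i :: nat
      by real_asymp
    have "((\<lambda>t. \<Sum>i\<le>n. coeff (laguerre n (a+1)) i * (exp (- t) * t powr (a + 1) * t ^ i)) \<longlongrightarrow> 0) at_top"
      by (rule tendsto_null_sum) (rule tendsto_mult_right_zero[OF mono])
    moreover have "f = (\<lambda>t. \<Sum>i\<le>n. coeff (laguerre n (a+1)) i * (exp (- t) * t powr (a + 1) * t ^ i))"
      using Suc.prems by (simp add: f_def poly_altdef degree_laguerre sum_distrib_left mult_ac)
    ultimately show ?thesis by simp
  qed
  have "\<exists>x>M. poly (laguerre (Suc n) a) x = 0"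
  \<comment> \<open>For \<open>n = 0\<close> the last zero \<open>M\<close> is \<open>0\<close>, where \<open>f\<close> need not be differentiable.\<close>
  proof (cases "n = 0")
    case True
    have "M = 0" using True S M by (auto simp: S0_def)
    moreover have "laguerre 1 a = [:rGamma (a+1), - rGamma (a+2):]"
      by (rule poly_eqI) (auto simp: coeff_laguerre coeff_pCons algebra_simps split: nat.splits)
    ultimately show ?thesis
      using True rGamma_pos[of "a+1"] rGamma_pos[of "a+2"] Suc.prems
      by (intro exI[of _ "rGamma (a+1) / rGamma (a+2)"]) auto
  next
    case False
    have "M > 0"
    proof -
      obtain s where "s \<in> S" using S False by fastforce
      then have "s > 0" "s \<le> M" using S S0 by (auto simp: M_def S0_def)
      then show ?thesis by auto
    qed
    have "\<exists>x>M. f' x = 0"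
    proof (rule rolle_at_infinity[OF _ lim])
      show "f M = 0" using S0 M by auto
      show "continuous_on {M..} f'"
        unfolding f'_def using \<open>M > 0\<close> by (intro continuous_intros) auto
    qed (use der \<open>M > 0\<close> in auto)
    then show ?thesis using \<open>M > 0\<close> by (auto simp: f'_def)
  qed
  then obtain z where z: "z > M" "poly (laguerre (Suc n) a) z = 0" by auto
  show ?case
  proof (intro exI[of _ "insert z T"] conjI ballI)
    show "card (insert z T) = Suc n"
      using T z by (subst card_insert_disjoint) (auto simp: M_def)
    show "insert z T \<subseteq> {0<..}"
      using T z \<open>M \<ge> 0\<close> \<open>Min S0 = 0\<close> by auto
    fix t assume "t \<in> insert z T"
    then show "poly (laguerre (Suc n) a) t = 0"
      using z(2) T(3,4) \<open>Min S0 = 0\<close> by (auto simp: f'_def)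
  qed (use T in auto)
qed

section \<open>The entire functions behind the Bessel function and its derivative\<close>

text \<open>The coefficients of the Bessel-Clifford function \<open>clifford \<nu>\<close>, scaled such that
  \<open>bessel_J \<nu> x = (x / 2) powr \<nu> * clifford \<nu> (x\<^sup>2)\<close>.\<close>

definition clifford_coeff :: "real \<Rightarrow> nat \<Rightarrow> real" where
  "clifford_coeff \<nu> m = (- 1) ^ m * rGamma (real m + \<nu> + 1) / (4 ^ m * fact m)"

text \<open>The operator \<open>\<nu> + 2 * s * d/ds\<close>, acting on power series in \<open>s = x\<^sup>2\<close>, corresponds to
  \<open>x * d/dx\<close> acting on \<open>bessel_J \<nu>\<close>. Hence \<open>dbessel \<nu> (x\<^sup>2)\<close> is a multiple of the derivative of
  \<open>bessel_J \<nu>\<close> at \<open>x\<close>.\<close>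

definition dbessel_coeff :: "real \<Rightarrow> nat \<Rightarrow> real" where
  "dbessel_coeff \<nu> m = (2 * real m + \<nu>) * clifford_coeff \<nu> m"

lemma dbessel_coeff_nz: "-1 < \<nu> \<Longrightarrow> \<nu> < 0 \<Longrightarrow> dbessel_coeff \<nu> m \<noteq> 0"
  using rGamma_pos[of "real m + \<nu> + 1"] by (cases m) (auto simp: dbessel_coeff_def clifford_coeff_def)

lemma dbessel_coeff_sign:
  assumes "-1 < \<nu>" "m \<ge> 1"
  shows "dbessel_coeff \<nu> m * (- 1) ^ m > 0"
proof -
  have "rGamma (real m + \<nu> + 1) > 0" using assms by (intro rGamma_pos) auto
  moreover have "dbessel_coeff \<nu> m * (- 1) ^ m
      = (2 * real m + \<nu>) * rGamma (real m + \<nu> + 1) / (4 ^ m * fact m)"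
    by (cases "even m") (simp_all add: dbessel_coeff_def clifford_coeff_def)
  ultimately show ?thesis using assms by simp
qed

lemma dbessel_coeff_0_neg: "-1 < \<nu> \<Longrightarrow> \<nu> < 0 \<Longrightarrow> dbessel_coeff \<nu> 0 < 0"
  using rGamma_pos[of "\<nu> + 1"] by (simp add: dbessel_coeff_def clifford_coeff_def mult_neg_pos)

definition clifford :: "real \<Rightarrow> real \<Rightarrow> real" where
  "clifford \<nu> s = (\<Sum>m. clifford_coeff \<nu> m * s ^ m)"

definition clifford' :: "real \<Rightarrow> real \<Rightarrow> real" where
  "clifford' \<nu> s = (\<Sum>m. diffs (clifford_coeff \<nu>) m * s ^ m)"

definition dbessel :: "real \<Rightarrow> real \<Rightarrow> real" where
  "dbessel \<nu> s = (\<Sum>m. dbessel_coeff \<nu> m * s ^ m)"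

definition dbessel' :: "real \<Rightarrow> real \<Rightarrow> real" where
  "dbessel' \<nu> s = (\<Sum>m. diffs (dbessel_coeff \<nu>) m * s ^ m)"

lemma clifford_coeff_Suc:
  "4 * (real m + 1) * (real m + 1 + \<nu>) * clifford_coeff \<nu> (Suc m) = - clifford_coeff \<nu> m"
proof -
  have "rGamma (real m + \<nu> + 1) = (real m + 1 + \<nu>) * rGamma (real (Suc m) + \<nu> + 1)"
    using rGamma_plus1[of "real m + \<nu> + 1"] by (simp add: add_ac)
  then show ?thesis by (simp add: clifford_coeff_def divide_simps)
qed

lemma summable_clifford:
  assumes "-1 < \<nu>"
  shows "summable (\<lambda>m. clifford_coeff \<nu> m * s ^ m)"
proof -
  obtain N :: nat where N: "\<bar>s\<bar> \<le> real N" using real_arch_simple by blast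
  show ?thesis
  proof (rule summable_ratio_test)
  show "(1 / 2 :: real) < 1" by simp
  fix m assume m: "m \<ge> N + 1"
  define D where "D = 4 * (real m + 1) * (real m + 1 + \<nu>)"
  have "(real m + 1) * (real m + 1 + \<nu>) \<ge> real m * 1"
    using m assms by (intro mult_mono) auto
  moreover have "D = 4 * ((real m + 1) * (real m + 1 + \<nu>))" by (simp add: D_def)
  moreover have "real m \<ge> 1" "\<bar>s\<bar> \<le> real m" using N m by auto
  ultimately have D: "D \<ge> 2 * \<bar>s\<bar>" "D > 0" by linarith+
  have "D * clifford_coeff \<nu> (Suc m) = - clifford_coeff \<nu> m" unfolding D_def by (rule clifford_coeff_Suc)
  then have b: "\<bar>clifford_coeff \<nu> m\<bar> = D * \<bar>clifford_coeff \<nu> (Suc m)\<bar>"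
    using D by (metis abs_minus_cancel abs_mult abs_of_pos)
  have "\<bar>clifford_coeff \<nu> (Suc m)\<bar> * (2 * \<bar>s\<bar>) \<le> \<bar>clifford_coeff \<nu> (Suc m)\<bar> * D"
    using D by (intro mult_left_mono) auto
  then have "2 * (\<bar>clifford_coeff \<nu> (Suc m)\<bar> * \<bar>s\<bar>) * \<bar>s\<bar> ^ m \<le> \<bar>clifford_coeff \<nu> m\<bar> * \<bar>s\<bar> ^ m"
    unfolding b by (intro mult_right_mono) (auto simp: mult_ac)
  then show "norm (clifford_coeff \<nu> (Suc m) * s ^ Suc m) \<le> 1 / 2 * norm (clifford_coeff \<nu> m * s ^ m)"
    by (simp add: abs_mult power_abs mult_ac)
  qed
qed

lemma powser_times_index_sums:
  fixes c :: "nat \<Rightarrow> real"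
  assumes "\<And>x. summable (\<lambda>m. c m * x ^ m)"
  shows "(\<lambda>m. real m * c m * s ^ m) sums (s * (\<Sum>m. diffs c m * s ^ m))"
proof -
  have "summable (\<lambda>m. diffs c m * s ^ m)" by (rule termdiff_converges_all) (rule assms)
  from sums_mult[OF diffs_equiv[OF this], of s]
  have "(\<lambda>m. s * (real m * c m * s ^ (m - Suc 0))) sums (s * (\<Sum>m. diffs c m * s ^ m))" .
  moreover have "s * (real m * c m * s ^ (m - Suc 0)) = real m * c m * s ^ m" for m
    by (cases m) auto
  ultimately show ?thesis by simp
qed

lemma dbessel_sums:
  assumes "-1 < \<nu>"
  shows "(\<lambda>m. dbessel_coeff \<nu> m * s ^ m) sums (\<nu> * clifford \<nu> s + 2 * s * clifford' \<nu> s)"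
proof -
  have "(\<lambda>m. \<nu> * (clifford_coeff \<nu> m * s ^ m) + 2 * (real m * clifford_coeff \<nu> m * s ^ m)) sums
      (\<nu> * clifford \<nu> s + 2 * (s * clifford' \<nu> s))"
    unfolding clifford_def clifford'_def
    by (intro sums_add sums_mult summable_sums powser_times_index_sums summable_clifford assms)
  then show ?thesis by (simp add: dbessel_coeff_def algebra_simps)
qed

lemma summable_dbessel: "-1 < \<nu> \<Longrightarrow> summable (\<lambda>m. dbessel_coeff \<nu> m * s ^ m)"
  using dbessel_sums sums_summable by blast

lemma dbessel_eq: "-1 < \<nu> \<Longrightarrow> dbessel \<nu> s = \<nu> * clifford \<nu> s + 2 * s * clifford' \<nu> s"
  unfolding dbessel_def by (rule sums_unique[symmetric, OF dbessel_sums])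

lemma DERIV_clifford: "-1 < \<nu> \<Longrightarrow> (clifford \<nu> has_real_derivative clifford' \<nu> s) (at s)"
  unfolding clifford_def[abs_def] clifford'_def
  by (rule termdiffs_strong_converges_everywhere) (rule summable_clifford)

lemma DERIV_dbessel: "-1 < \<nu> \<Longrightarrow> (dbessel \<nu> has_real_derivative dbessel' \<nu> s) (at s)"
  unfolding dbessel_def[abs_def] dbessel'_def
  by (rule termdiffs_strong_converges_everywhere) (rule summable_dbessel)

lemma continuous_dbessel': "-1 < \<nu> \<Longrightarrow> continuous_on A (dbessel' \<nu>)"
proof (rule DERIV_continuous_on)
  fix s assume nu: "-1 < \<nu>"
  show "(dbessel' \<nu> has_real_derivative (\<Sum>m. diffs (diffs (dbessel_coeff \<nu>)) m * s ^ m)) (at s within A)"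
    unfolding dbessel'_def[abs_def]
    by (rule has_field_derivative_at_within[OF termdiffs_strong_converges_everywhere])
      (intro termdiff_converges_all summable_dbessel nu)
qed

text \<open>Bessel's equation in the variable \<open>s = x\<^sup>2\<close>; on coefficients it is \<open>clifford_coeff_Suc\<close>.\<close>

lemma clifford_ode:
  assumes "-1 < \<nu>"
  shows "\<exists>B2. (clifford' \<nu> has_real_derivative B2) (at s) \<and> 4 * s * B2 + 4 * (\<nu> + 1) * clifford' \<nu> s + clifford \<nu> s = 0"
proof -
  define c where "c = diffs (clifford_coeff \<nu>)"
  have c: "summable (\<lambda>m. c m * x ^ m)" for x
    unfolding c_def by (rule termdiff_converges_all) (rule summable_clifford[OF assms])
  define B2 where "B2 = (\<Sum>m. diffs c m * s ^ m)"
  have "(\<lambda>m. 4 * (real m * c m * s ^ m) + 4 * (\<nu> + 1) * (c m * s ^ m) + clifford_coeff \<nu> m * s ^ m) sums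
     (4 * (s * B2) + 4 * (\<nu> + 1) * clifford' \<nu> s + clifford \<nu> s)"
    unfolding B2_def clifford'_def clifford_def c_def[symmetric]
    by (rule sums_add[OF sums_add[OF sums_mult sums_mult]])
      (rule powser_times_index_sums[OF c] summable_sums[OF c] summable_sums[OF summable_clifford[OF assms]])+
  moreover have "4 * (real m * c m * s ^ m) + 4 * (\<nu> + 1) * (c m * s ^ m) + clifford_coeff \<nu> m * s ^ m
      = (4 * (real m + 1) * (real m + 1 + \<nu>) * clifford_coeff \<nu> (Suc m) + clifford_coeff \<nu> m) * s ^ m" for m
    by (simp add: c_def diffs_def algebra_simps)
  ultimately have "(\<lambda>m. 0) sums (4 * (s * B2) + 4 * (\<nu> + 1) * clifford' \<nu> s + clifford \<nu> s)"
    by (simp only: clifford_coeff_Suc) simp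
  then have "4 * s * B2 + 4 * (\<nu> + 1) * clifford' \<nu> s + clifford \<nu> s = 0"
    using sums_unique2[OF sums_zero] by force
  moreover have "(clifford' \<nu> has_real_derivative B2) (at s)"
    unfolding clifford'_def[abs_def] B2_def c_def[symmetric]
    by (rule termdiffs_strong_converges_everywhere) (rule c)
  ultimately show ?thesis by blast
qed

text \<open>Eliminating \<open>clifford'\<close> from Bessel's equation makes the right side vanish at \<open>s = \<nu>\<^sup>2\<close>, which
  determines the logarithmic derivative of \<open>dbessel \<nu>\<close> there.\<close>

lemma dbessel_ode:
  assumes "-1 < \<nu>"
  shows "2 * s * dbessel' \<nu> s + \<nu> * dbessel \<nu> s = (\<nu>\<^sup>2 - s) * clifford \<nu> s"
proof -
  obtain B2 where B2: "(clifford' \<nu> has_real_derivative B2) (at s)"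
    "4 * s * B2 + 4 * (\<nu> + 1) * clifford' \<nu> s + clifford \<nu> s = 0"
    using clifford_ode[OF assms] by blast
  have "((\<lambda>s. \<nu> * clifford \<nu> s + 2 * s * clifford' \<nu> s) has_real_derivative
      (\<nu> * clifford' \<nu> s + 2 * clifford' \<nu> s + 2 * s * B2)) (at s)"
    by (auto intro!: derivative_eq_intros DERIV_clifford assms B2 simp: algebra_simps)
  then have "(dbessel \<nu> has_real_derivative (\<nu> * clifford' \<nu> s + 2 * clifford' \<nu> s + 2 * s * B2)) (at s)"
    using dbessel_eq[OF assms] by presburger
  then have "dbessel' \<nu> s = \<nu> * clifford' \<nu> s + 2 * clifford' \<nu> s + 2 * s * B2"
    using DERIV_dbessel[OF assms] DERIV_unique by blast
  then have "2 * dbessel' \<nu> s = - 2 * \<nu> * clifford' \<nu> s - clifford \<nu> s" using B2(2) by (simp add: algebra_simps)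
  then have "2 * s * dbessel' \<nu> s = s * (- 2 * \<nu> * clifford' \<nu> s - clifford \<nu> s)" by (metis mult.assoc mult.commute)
  then show ?thesis by (simp add: dbessel_eq[OF assms] algebra_simps power2_eq_square)
qed

lemma clifford_at_0: "clifford \<nu> 0 = rGamma (\<nu> + 1)"
  unfolding clifford_def using powser_sums_zero[of "clifford_coeff \<nu>"] by (simp add: sums_iff clifford_coeff_def)

lemma dbessel_at_0: "dbessel \<nu> 0 = dbessel_coeff \<nu> 0"
  unfolding dbessel_def using powser_sums_zero[of "dbessel_coeff \<nu>"] by (simp add: sums_iff)

text \<open>An energy argument in place of uniqueness for the initial value problem, which is singular at \<open>0\<close>:
  a nonnegative nondecreasing quantity that vanishes at \<open>s0\<close> vanishes on \<open>(0, s0)\<close>, and then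
  \<open>clifford \<nu> 0 = 0\<close> by continuity.\<close>

lemma clifford_no_double_zero:
  assumes "-1 < \<nu>" "\<nu> < 0" "s0 > 0" "clifford \<nu> s0 = 0" "clifford' \<nu> s0 = 0"
  shows False
proof -
  \<comment> \<open>Multiplying the usual energy by \<open>s\<close> makes it monotone: for \<open>s > 0\<close>
    the derivative is a combination of squares with positive coefficients, as \<open>\<nu> < 0\<close>.\<close>
  define F where "F = (\<lambda>s. s * (s * (clifford' \<nu> s)\<^sup>2 + (clifford \<nu> s)\<^sup>2 / 4))"
  have der: "(F has_real_derivative ((clifford \<nu> s)\<^sup>2 / 4 - 2 * \<nu> * s * (clifford' \<nu> s)\<^sup>2)) (at s)" for s
  proof -
    obtain B2 where B2: "(clifford' \<nu> has_real_derivative B2) (at s)"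
      "4 * s * B2 + 4 * (\<nu> + 1) * clifford' \<nu> s + clifford \<nu> s = 0"
      using clifford_ode[OF assms(1)] by blast
    have sB2: "s * B2 = - (\<nu> + 1) * clifford' \<nu> s - clifford \<nu> s / 4" using B2(2) by (simp add: algebra_simps)
    have "(F has_real_derivative (2 * s * (clifford' \<nu> s)\<^sup>2 + (clifford \<nu> s)\<^sup>2 / 4
       + s * (2 * clifford' \<nu> s * (s * B2) + clifford \<nu> s * clifford' \<nu> s / 2))) (at s)"
      unfolding F_def
      by (auto intro!: derivative_eq_intros DERIV_clifford assms B2 simp: algebra_simps power2_eq_square)
    then show ?thesis unfolding sB2 by (simp add: algebra_simps power2_eq_square)
  qed
  have zero: "clifford \<nu> s = 0" if "s \<in> {0<..<s0}" for s
  proof -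
    have "F s \<le> F s0"
    proof (rule DERIV_nonneg_imp_nondecreasing[of s s0 F])
      fix x assume "s \<le> x"
      have "(clifford \<nu> x)\<^sup>2 / 4 - 2 * \<nu> * x * (clifford' \<nu> x)\<^sup>2 \<ge> 0"
      proof -
        have "\<nu> * x \<le> 0" using that assms \<open>s \<le> x\<close> by (intro mult_nonpos_nonneg) auto
        then have "\<nu> * x * (clifford' \<nu> x)\<^sup>2 \<le> 0" by (rule mult_nonpos_nonneg) simp
        then show ?thesis using zero_le_power2[of "clifford \<nu> x"] by linarith
      qed
      with der show "\<exists>y. (F has_real_derivative y) (at x) \<and> 0 \<le> y" by blast
    qed (use that in auto)
    then have "s * (s * (clifford' \<nu> s)\<^sup>2 + (clifford \<nu> s)\<^sup>2 / 4) \<le> 0" using assms by (simp add: F_def)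
    then have "s * (clifford' \<nu> s)\<^sup>2 + (clifford \<nu> s)\<^sup>2 / 4 \<le> 0" using that by (simp add: mult_le_0_iff)
    moreover have "s * (clifford' \<nu> s)\<^sup>2 \<ge> 0" using that by simp
    ultimately have "(clifford \<nu> s)\<^sup>2 \<le> 0" by linarith
    then show ?thesis by simp
  qed
  have "clifford \<nu> 0 = 0"
  proof (rule continuous_constant_on_closure[of "{0<..<s0}" "clifford \<nu>"])
    show "continuous_on (closure {0<..<s0}) (clifford \<nu>)"
      by (rule DERIV_continuous_on[of _ _ "clifford' \<nu>"])
        (auto intro!: has_field_derivative_at_within DERIV_clifford assms)
    show "0 \<in> closure {0<..<s0}" using assms by (simp add: closure_greaterThanLessThan)
  qed (rule zero)
  then show False using rGamma_pos[of "\<nu> + 1"] assms by (simp add: clifford_at_0)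
qed

text \<open>The constant coefficient is negative. The other terms of the series alternate, do not
  start with a positive one, and decrease in absolute value as long as \<open>s \<le> 1\<close>, so their sum is not positive.\<close>

lemma dbessel_neg:
  assumes "-1 < \<nu>" "\<nu> < 0" "0 \<le> s" "s \<le> 1"
  shows "dbessel \<nu> s < 0"
proof -
  define A where "A = (\<lambda>m. dbessel_coeff \<nu> m * (- 1) ^ m)"
  define a where "a = (\<lambda>i. A (Suc i) * s ^ Suc i)"
  have A_pos: "A m > 0" if "m \<ge> 1" for m using dbessel_coeff_sign that assms by (auto simp: A_def)
  have A_dec: "A (Suc m) \<le> A m" if "m \<ge> 1" for m
  proof -
    define D where "D = 4 * (real m + 1) * (real m + 1 + \<nu>) * (2 * real m + \<nu>)"
    define N where "N = 2 * real m + 2 + \<nu>"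
    have m: "real m \<ge> 1" using that by simp
    have "(real m + 1) * (real m + 1 + \<nu>) \<ge> 2 * 1" using m assms by (intro mult_mono) auto
    then have "(real m + 1) * (real m + 1 + \<nu>) * (2 * real m + \<nu>) \<ge> 2 * (2 * real m + \<nu>)"
      using m assms by (intro mult_right_mono) auto
    then have "4 * (2 * (2 * real m + \<nu>)) \<le> 4 * ((real m + 1) * (real m + 1 + \<nu>) * (2 * real m + \<nu>))"
      by (rule mult_left_mono) simp
    also have "\<dots> = D" by (simp only: D_def mult.assoc)
    finally have "2 * real m + 2 + \<nu> \<le> D" using m assms(1) by argo
    then have "N \<le> D" "N > 0" using m assms by (simp_all add: N_def)
    have e: "D * A (Suc m) = N * A m"
    proof -
      have "4 * (real m + 1) * (real m + 1 + \<nu>) * dbessel_coeff \<nu> (Suc m) = - N * clifford_coeff \<nu> m"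
        using arg_cong[OF clifford_coeff_Suc[of m \<nu>], of "\<lambda>x. N * x"] by (simp add: dbessel_coeff_def N_def algebra_simps)
      note rec = this
      have "D * dbessel_coeff \<nu> (Suc m)
          = (4 * (real m + 1) * (real m + 1 + \<nu>) * dbessel_coeff \<nu> (Suc m)) * (2 * real m + \<nu>)"
        by (simp only: D_def mult_ac)
      also have "\<dots> = - N * dbessel_coeff \<nu> m" unfolding rec by (simp add: dbessel_coeff_def)
      finally have "D * dbessel_coeff \<nu> (Suc m) = - N * dbessel_coeff \<nu> m" .
      then show ?thesis by (cases "even m") (simp_all add: A_def)
    qed
    have "N * A (Suc m) \<le> D * A (Suc m)"
      using \<open>N \<le> D\<close> A_pos[of "Suc m"] by (intro mult_right_mono) auto
    then show ?thesis unfolding e using \<open>N > 0\<close> by simp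
  qed
  have terms: "dbessel_coeff \<nu> (Suc i) * s ^ Suc i = - ((- 1) ^ i * a i)" for i
    by (simp add: a_def A_def)
  have sumS: "summable (\<lambda>i. dbessel_coeff \<nu> (Suc i) * s ^ Suc i)"
    using summable_dbessel[OF assms(1)] by (subst summable_Suc_iff)
  have "a \<longlonglongrightarrow> 0"
  proof -
    have "(\<lambda>i. \<bar>dbessel_coeff \<nu> (Suc i) * s ^ Suc i\<bar>) \<longlonglongrightarrow> 0"
      using summable_LIMSEQ_zero[OF sumS] by (simp only: tendsto_rabs_zero_iff)
    moreover have "\<bar>dbessel_coeff \<nu> (Suc i) * s ^ Suc i\<bar> = a i" for i
      using A_pos[of "Suc i"] assms unfolding terms by (simp add: abs_mult a_def)
    ultimately show ?thesis by simp
  qed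
  moreover have "a i \<ge> 0" for i using A_pos[of "Suc i"] assms by (simp add: a_def)
  moreover have "a (Suc i) \<le> a i" for i
  proof -
    have "s ^ Suc (Suc i) \<le> s ^ Suc i" using assms by (intro power_decreasing) auto
    then show ?thesis unfolding a_def
      using A_dec[of "Suc i"] A_pos[of "Suc i"] assms by (intro mult_mono) auto
  qed
  ultimately have "(\<Sum>i. (- 1) ^ i * a i) \<ge> (\<Sum>i<2 * 0. (- 1) ^ i * a i)"
    by (rule summable_Leibniz'(2))
  moreover have "dbessel \<nu> s = dbessel_coeff \<nu> 0 - (\<Sum>i. (- 1) ^ i * a i)"
  proof -
    have "dbessel \<nu> s = (\<Sum>i. dbessel_coeff \<nu> (Suc i) * s ^ Suc i) + dbessel_coeff \<nu> 0"
      unfolding dbessel_def using suminf_split_head[OF summable_dbessel[OF assms(1), of s]] by simp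
    also have "(\<Sum>i. dbessel_coeff \<nu> (Suc i) * s ^ Suc i) = - (\<Sum>i. (- 1) ^ i * a i)"
      using suminf_minus[OF summable_minus[OF sumS[unfolded terms], unfolded minus_minus]] by (simp only: terms)
    finally show ?thesis by simp
  qed
  ultimately show ?thesis using dbessel_coeff_0_neg assms by force
qed

text \<open>For \<open>s \<le> 0\<close> no term of the differentiated series is positive, since \<open>dbessel_coeff \<nu> m\<close> has the
  sign of \<open>(- 1) ^ m\<close> for \<open>m \<ge> 1\<close>.\<close>

lemma dbessel'_neg:
  assumes "-1 < \<nu>" "s \<le> 0"
  shows "dbessel' \<nu> s \<le> dbessel_coeff \<nu> 1"
proof -
  have sm: "summable (\<lambda>m. diffs (dbessel_coeff \<nu>) m * s ^ m)"
    by (rule termdiff_converges_all) (rule summable_dbessel[OF assms(1)])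
  have "diffs (dbessel_coeff \<nu>) m * s ^ m \<le> 0" for m
  proof -
    have "diffs (dbessel_coeff \<nu>) m * s ^ m = - (real (Suc m) * (dbessel_coeff \<nu> (Suc m) * (- 1) ^ Suc m) * (- s) ^ m)"
      by (simp add: diffs_def power_minus[of s])
    moreover have "real (Suc m) * (dbessel_coeff \<nu> (Suc m) * (- 1) ^ Suc m) * (- s) ^ m \<ge> 0"
      using dbessel_coeff_sign[of \<nu> "Suc m"] assms
      by (intro mult_nonneg_nonneg zero_le_power order.strict_implies_order[of 0 "_ * (- 1) ^ _"]) auto
    ultimately show ?thesis by simp
  qed
  then have le: "diffs (dbessel_coeff \<nu>) (Suc m) * s ^ Suc m \<le> 0" for m by blast
  have "(\<Sum>m. diffs (dbessel_coeff \<nu>) (Suc m) * s ^ Suc m) \<le> (\<Sum>m::nat. 0)"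
  proof (rule suminf_le)
    show "summable (\<lambda>m. diffs (dbessel_coeff \<nu>) (Suc m) * s ^ Suc m)" using sm by (subst summable_Suc_iff)
  qed (use le in \<open>simp_all del: power_Suc\<close>)
  moreover have "dbessel' \<nu> s = (\<Sum>m. diffs (dbessel_coeff \<nu>) (Suc m) * s ^ Suc m) + dbessel_coeff \<nu> 1"
    unfolding dbessel'_def using suminf_split_head[OF sm] by (simp add: diffs_def)
  ultimately show ?thesis by simp
qed

text \<open>By \<open>dbessel_ode\<close> a double zero \<open>s \<noteq> \<nu>\<^sup>2\<close> would be a zero of \<open>clifford \<nu>\<close>, in fact a double
  one. The exceptional point \<open>\<nu>\<^sup>2\<close> is covered by \<open>dbessel_neg\<close>.\<close>

lemma dbessel_simple_zeros:
  assumes nu: "-1 < \<nu>" "\<nu> < 0" and z: "dbessel \<nu> s = 0"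
  shows "dbessel' \<nu> s \<noteq> 0"
proof (cases "s > 0")
  case True
  have sn: "s \<noteq> \<nu>\<^sup>2"
    using dbessel_neg[OF nu, of "\<nu>\<^sup>2"] z nu by (auto simp: abs_square_le_1)
  show ?thesis
  proof
    assume "dbessel' \<nu> s = 0"
    then have "clifford \<nu> s = 0" using dbessel_ode[OF nu(1), of s] z sn by simp
    moreover from this have "clifford' \<nu> s = 0" using dbessel_eq[OF nu(1), of s] z True by simp
    ultimately show False using clifford_no_double_zero nu True by blast
  qed
next
  case False
  then show ?thesis using dbessel'_neg[OF nu(1), of s] dbessel_coeff_sign[OF nu(1), of 1] by simp
qed

lemma dbessel_neg_zero:
  assumes nu: "-1 < \<nu>" "\<nu> < 0"
  shows "\<exists>!s. s < 0 \<and> dbessel \<nu> s = 0"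
proof -
  define g1 where "g1 = - dbessel_coeff \<nu> 1"
  have g1: "g1 > 0" using dbessel_coeff_sign[OF nu(1), of 1] by (simp add: g1_def)
  have bound: "dbessel \<nu> x - dbessel \<nu> y \<ge> g1 * (y - x)" if "x \<le> y" "y \<le> 0" for x y
  proof -
    have "dbessel \<nu> x + g1 * x \<ge> dbessel \<nu> y + g1 * y"
    proof (rule DERIV_nonpos_imp_nonincreasing[OF that(1)])
      fix t assume "x \<le> t" "t \<le> y"
      have "((\<lambda>t. dbessel \<nu> t + g1 * t) has_real_derivative dbessel' \<nu> t + g1) (at t)"
        by (auto intro!: derivative_eq_intros DERIV_dbessel nu)
      moreover have "dbessel' \<nu> t + g1 \<le> 0"
        using dbessel'_neg[OF nu(1), of t] \<open>t \<le> y\<close> that by (simp add: g1_def)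
      ultimately show "\<exists>D. ((\<lambda>t. dbessel \<nu> t + g1 * t) has_real_derivative D) (at t) \<and> D \<le> 0" by blast
    qed
    then show ?thesis by (simp add: algebra_simps)
  qed
  \<comment> \<open>On the negative axis the graph lies above its tangent at \<open>0\<close>, which meets the axis at \<open>- K\<close>.\<close>
  define K where "K = - dbessel_coeff \<nu> 0 / g1"
  have K: "K > 0" using g1 dbessel_coeff_0_neg[OF nu] by (simp add: K_def divide_neg_pos)
  have "g1 * K = - dbessel_coeff \<nu> 0" using g1 by (simp add: K_def)
  then have "dbessel \<nu> (- K) \<ge> 0" using bound[of "- K" 0] K by (simp add: dbessel_at_0)
  moreover have "continuous_on {-K..0} (dbessel \<nu>)"
    by (rule DERIV_continuous_on[of _ _ "dbessel' \<nu>"])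
      (auto intro!: has_field_derivative_at_within DERIV_dbessel nu)
  ultimately obtain s where s: "s \<le> 0" "dbessel \<nu> s = 0"
    using IVT2'[of "dbessel \<nu>" 0 0 "- K"] K dbessel_coeff_0_neg[OF nu] by (auto simp: dbessel_at_0)
  have "s \<noteq> 0" using s dbessel_coeff_0_neg[OF nu] by (auto simp: dbessel_at_0)
  show ?thesis
  proof (rule ex1I[of _ s])
    show "s < 0 \<and> dbessel \<nu> s = 0" using s \<open>s \<noteq> 0\<close> by auto
    fix t assume t: "t < 0 \<and> dbessel \<nu> t = 0"
    show "t = s"
      using bound[of s t] bound[of t s] s t g1 by (cases s t rule: linorder_cases) (auto simp: mult_le_0_iff)
  qed
qed

text \<open>With \<open>h\<close> and \<open>H\<close> the functions \<open>clifford \<nu>\<close> and \<open>dbessel \<nu>\<close> multiplied by \<open>s powr (\<nu> / 2)\<close>,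
  Bessel's equation becomes this first-order system. If \<open>H\<close> stays positive, \<open>h\<close> increases. Once
  \<open>h\<close> is positive it forces \<open>H\<close> to decrease at least linearly; if \<open>h\<close> never becomes positive,
  \<open>H\<close> increases and forces \<open>h\<close> to grow at least logarithmically.\<close>

lemma oscillation_pos:
  fixes h H :: "real \<Rightarrow> real"
  assumes nu: "\<nu>\<^sup>2 \<le> 1"
    and h: "\<And>s. s > 0 \<Longrightarrow> (h has_real_derivative H s / (2 * s)) (at s)"
    and H: "\<And>s. s > 0 \<Longrightarrow> (H has_real_derivative (\<nu>\<^sup>2 - s) * h s / (2 * s)) (at s)"
    and Y: "Y \<ge> 2" and pos: "\<And>s. s \<ge> Y \<Longrightarrow> H s > 0"
  shows False
proof -
  have h_mono: "h x \<le> h y" if "Y \<le> x" "x \<le> y" for x y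
  proof (rule DERIV_nonneg_imp_nondecreasing[OF that(2)])
    fix t assume "x \<le> t"
    then have "t > 0" "H t > 0" using that Y pos by auto
    then show "\<exists>D. (h has_real_derivative D) (at t) \<and> 0 \<le> D"
      using h by (intro exI[of _ "H t / (2 * t)"]) auto
  qed
  show False
  proof (cases "\<exists>y\<ge>Y. h y > 0")
    case True
    then obtain y where y: "y \<ge> Y" "h y > 0" by auto
    define c where "c = h y"
    \<comment> \<open>The point where the linear upper bound for \<open>H\<close> reaches \<open>0\<close>.\<close>
    define x where "x = y + 4 * H y / c"
    have c: "c > 0" using y by (simp add: c_def)
    have "x \<ge> y" using c pos[of y] y by (simp add: x_def)
    have "H y + c / 4 * y \<ge> H x + c / 4 * x"
    proof (rule DERIV_nonpos_imp_nonincreasing[OF \<open>x \<ge> y\<close>])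
      fix t assume t: "y \<le> t"
      then have t2: "t \<ge> 2" "h t \<ge> c" using y Y h_mono by (auto simp: c_def)
      have "((\<lambda>x. H x + c / 4 * x) has_real_derivative (\<nu>\<^sup>2 - t) * h t / (2 * t) + c / 4) (at t)"
        using t2 by (auto intro!: derivative_eq_intros H)
      moreover have "(\<nu>\<^sup>2 - t) * h t / (2 * t) + c / 4 \<le> 0"
      proof -
        have "(t - \<nu>\<^sup>2) * h t \<ge> (t / 2) * c" using t2 nu c by (intro mult_mono) auto
        then show ?thesis using t2 by (simp add: field_simps)
      qed
      ultimately show "\<exists>D. ((\<lambda>x. H x + c / 4 * x) has_real_derivative D) (at t) \<and> D \<le> 0" by blast
    qed
    moreover have "c / 4 * x = c / 4 * y + H y" using c by (simp add: x_def field_simps)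
    ultimately have "H x \<le> 0" by linarith
    then show False using pos[of x] \<open>x \<ge> y\<close> y by simp
  next
    case False
    then have h_neg: "h y \<le> 0" if "y \<ge> Y" for y using that by force
    have H_mono: "H Y \<le> H y" if "Y \<le> y" for y
    proof (rule DERIV_nonneg_imp_nondecreasing[OF that])
      fix t assume t: "Y \<le> t"
      then have "(\<nu>\<^sup>2 - t) * h t \<ge> 0" using h_neg[of t] Y nu by (intro mult_nonpos_nonpos) auto
      then show "\<exists>D. (H has_real_derivative D) (at t) \<and> 0 \<le> D"
        using H[of t] t Y by (intro exI[of _ "(\<nu>\<^sup>2 - t) * h t / (2 * t)"]) auto
    qed
    define c where "c = H Y"
    have c: "c > 0" using pos[of Y] by (simp add: c_def)
    \<comment> \<open>The point where the logarithmic lower bound for \<open>h\<close> reaches \<open>1\<close>.\<close>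
    define x where "x = Y * exp (2 * (1 - h Y) / c)"
    have "exp (2 * (1 - h Y) / c) \<ge> 1" using c h_neg[of Y] by simp
    then have "x \<ge> Y" using Y by (simp add: x_def)
    have "h Y - c / 2 * ln Y \<le> h x - c / 2 * ln x"
    proof (rule DERIV_nonneg_imp_nondecreasing[OF \<open>x \<ge> Y\<close>])
      fix t assume t: "Y \<le> t"
      have "((\<lambda>x. h x - c / 2 * ln x) has_real_derivative H t / (2 * t) - c / 2 * (1 / t)) (at t)"
        using t Y by (auto intro!: derivative_eq_intros h)
      moreover have "H t / (2 * t) - c / 2 * (1 / t) \<ge> 0"
        using H_mono[OF t] t Y by (simp add: c_def field_simps)
      ultimately show "\<exists>D. ((\<lambda>x. h x - c / 2 * ln x) has_real_derivative D) (at t) \<and> 0 \<le> D" by blast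
    qed
    moreover have "ln x = ln Y + 2 * (1 - h Y) / c" using Y by (simp add: x_def ln_mult)
    ultimately have "h x \<ge> 1" using c by (simp add: field_simps)
    then show False using h_neg[OF \<open>x \<ge> Y\<close>] by simp
  qed
qed

lemma dbessel_zeros_unbounded:
  assumes nu: "-1 < \<nu>" "\<nu> < 0"
  shows "\<exists>s>X. dbessel \<nu> s = 0"
proof (rule ccontr)
  assume "\<not> ?thesis"
  then have nz: "dbessel \<nu> s \<noteq> 0" if "s > X" for s using that by auto
  define Y where "Y = max 2 (X + 1)"
  have nu1: "\<nu>\<^sup>2 \<le> 1" using nu by (auto simp: abs_square_le_1)
  define h where "h = (\<lambda>s. s powr (\<nu> / 2) * clifford \<nu> s)"
  define H where "H = (\<lambda>s. s powr (\<nu> / 2) * dbessel \<nu> s)"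
  have p: "((\<lambda>s. s powr (\<nu> / 2)) has_real_derivative \<nu> * s powr (\<nu> / 2) / (2 * s)) (at s)"
    if "s > 0" for s
    using that by (auto intro!: derivative_eq_intros simp: powr_diff)
  have h: "(h has_real_derivative H s / (2 * s)) (at s)" if "s > 0" for s
  proof -
    have "(h has_real_derivative \<nu> * s powr (\<nu> / 2) / (2 * s) * clifford \<nu> s
       + s powr (\<nu> / 2) * clifford' \<nu> s) (at s)"
      unfolding h_def using DERIV_mult[OF p[OF that] DERIV_clifford[OF nu(1)]] by (simp add: mult_ac)
    then show ?thesis using that by (simp add: H_def dbessel_eq[OF nu(1)] field_simps)
  qed
  have H: "(H has_real_derivative (\<nu>\<^sup>2 - s) * h s / (2 * s)) (at s)" if "s > 0" for s
  proof -
    have "(H has_real_derivative \<nu> * s powr (\<nu> / 2) / (2 * s) * dbessel \<nu> s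
       + s powr (\<nu> / 2) * dbessel' \<nu> s) (at s)"
      unfolding H_def using DERIV_mult[OF p[OF that] DERIV_dbessel[OF nu(1)]] by (simp add: mult_ac)
    moreover have "(\<nu>\<^sup>2 - s) * h s = s powr (\<nu> / 2) * (2 * s * dbessel' \<nu> s + \<nu> * dbessel \<nu> s)"
      by (simp add: h_def dbessel_ode[OF nu(1)])
    then have "(\<nu>\<^sup>2 - s) * h s / (2 * s) = \<nu> * s powr (\<nu> / 2) / (2 * s) * dbessel \<nu> s
       + s powr (\<nu> / 2) * dbessel' \<nu> s" using that by (simp add: field_simps)
    ultimately show ?thesis by simp
  qed
  have "(\<forall>s\<in>{Y..}. dbessel \<nu> s > 0) \<or> (\<forall>s\<in>{Y..}. dbessel \<nu> s < 0)"
  proof (rule nonvanishing_sign)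
    show "continuous_on {Y..} (dbessel \<nu>)"
      by (rule DERIV_continuous_on[of _ _ "dbessel' \<nu>"])
        (auto intro!: has_field_derivative_at_within DERIV_dbessel nu)
  qed (use nz in \<open>auto simp: Y_def\<close>)
  then show False
  proof
    assume "\<forall>s\<in>{Y..}. dbessel \<nu> s > 0"
    then show False
      using oscillation_pos[OF nu1 h H, of Y] by (auto simp: H_def Y_def)
  next
    assume s: "\<forall>s\<in>{Y..}. dbessel \<nu> s < 0"
    show False
    proof (rule oscillation_pos[OF nu1, of "\<lambda>s. - h s" "\<lambda>s. - H s" Y])
      show "((\<lambda>s. - h s) has_real_derivative - H s / (2 * s)) (at s)" if "s > 0" for s
        using DERIV_minus[OF h[OF that]] by simp
      show "((\<lambda>s. - H s) has_real_derivative (\<nu>\<^sup>2 - s) * - h s / (2 * s)) (at s)" if "s > 0" for s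
        using DERIV_minus[OF H[OF that]] by simp
      show "- H x > 0" if "x \<ge> Y" for x
        using that s by (auto simp: H_def Y_def mult_pos_neg)
    qed (simp add: Y_def)
  qed
qed

lemma dbessel_finite_zeros:
  assumes nu: "-1 < \<nu>" "\<nu> < 0"
  shows "finite {s \<in> {a..b}. dbessel \<nu> s = 0}"
proof -
  have "finite ({a..b} \<inter> {s. dbessel \<nu> s = 0})"
  proof (rule finite_not_islimpt_in_compact)
    fix z :: real
    show "\<not> z islimpt {s. dbessel \<nu> s = 0}"
    proof
      assume "z islimpt {s. dbessel \<nu> s = 0}"
      then obtain f where f: "\<And>n. dbessel \<nu> (f n) = 0" "\<And>n. f n \<noteq> z" "f \<longlonglongrightarrow> z"
        unfolding islimpt_sequential by auto
      have "isCont (dbessel \<nu>) z" using DERIV_isCont[OF DERIV_dbessel[OF nu(1)]] .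
      then have "(\<lambda>n. dbessel \<nu> (f n)) \<longlonglongrightarrow> dbessel \<nu> z" using f(3) by (rule isCont_tendsto_compose)
      then have z: "dbessel \<nu> z = 0" by (simp add: f(1) LIMSEQ_const_iff)
      have "((\<lambda>x. (dbessel \<nu> x - dbessel \<nu> z) / (x - z)) \<longlongrightarrow> dbessel' \<nu> z) (at z)"
        using DERIV_dbessel[OF nu(1)] by (simp add: has_field_derivative_iff)
      moreover have "filterlim f (at z) sequentially"
        using f by (simp add: filterlim_at)
      ultimately have "(\<lambda>n. (dbessel \<nu> (f n) - dbessel \<nu> z) / (f n - z)) \<longlonglongrightarrow> dbessel' \<nu> z"
        by (rule filterlim_compose)
      then have "dbessel' \<nu> z = 0" by (simp add: f(1) z LIMSEQ_const_iff)
      with dbessel_simple_zeros[OF nu z] show False by simp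
    qed
  qed simp
  then show ?thesis by (simp add: Int_def)
qed

section \<open>Laguerre polynomials converging to the derivative of the Bessel function\<close>

text \<open>The quotient of the falling factorial \<open>n (n - 1) \<dots> (n - m + 1)\<close> by \<open>n ^ m\<close>.\<close>

definition weight :: "nat \<Rightarrow> nat \<Rightarrow> real" where
  "weight n m = real (n choose m) * fact m / real n ^ m"

text \<open>The operator \<open>\<nu> + 2 * t * d/dt\<close> that turns \<open>clifford \<nu>\<close> into \<open>dbessel \<nu>\<close> is applied to the
  Laguerre polynomial. Substituting \<open>t = s / (4 * n)\<close> is what makes the coefficients converge to
  those of \<open>dbessel \<nu>\<close>.\<close>

definition laguerre_approx :: "real \<Rightarrow> nat \<Rightarrow> real poly" where
  "laguerre_approx \<nu> n = pcompose (smult \<nu> (laguerre n \<nu>) + smult 2 (pCons 0 (pderiv (laguerre n \<nu>))))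
     [:0, 1 / (4 * real n):]"

lemma weight_Suc: "weight n (Suc m) = weight n m * ((real n - real m) / real n)"
proof -
  have "real (Suc m) * real (n choose Suc m) = (real n - real m) * real (n choose m)"
  proof (cases "m \<le> n")
    case True
    have "Suc m * (n choose Suc m) = (n - m) * (n choose m)"
      by (metis binomial_absorb_comp binomial_absorption)
    then show ?thesis using True by (metis of_nat_diff of_nat_mult)
  qed (simp add: binomial_eq_0)
  then have e: "real (n choose Suc m) * (1 + real m) = (real n - real m) * real (n choose m)" by (simp add: mult.commute add.commute)
  have "weight n (Suc m) = (real (n choose Suc m) * (1 + real m)) * fact m / (real n ^ m * real n)"
    by (simp add: weight_def mult_ac)
  also have "\<dots> = weight n m * ((real n - real m) / real n)" unfolding e by (simp add: weight_def)
  finally show ?thesis .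
qed

lemma weight_bounds: "0 \<le> weight n m" "weight n m \<le> 1"
proof -
  show nn: "0 \<le> weight n m" for m by (simp add: weight_def)
  show "weight n m \<le> 1"
  proof (induction m)
    case 0
    then show ?case by (simp add: weight_def)
  next
    case (Suc m)
    show ?case
    proof (cases "m < n")
      case True
      then have "weight n m * ((real n - real m) / real n) \<le> 1 * 1"
        using Suc nn by (intro mult_mono) auto
      then show ?thesis by (simp add: weight_Suc)
    next
      case False
      then show ?thesis by (simp add: weight_def binomial_eq_0)
    qed
  qed
qed

lemma weight_tendsto_1: "(\<lambda>n. weight n m) \<longlonglongrightarrow> 1"
proof (induction m)
  case 0
  then show ?case by (simp add: weight_def)
next
  case (Suc m)
  have "(\<lambda>n. (real n - real m) / real n) \<longlonglongrightarrow> 1" by real_asymp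
  from tendsto_mult[OF Suc this] show ?case by (simp add: weight_Suc)
qed

lemma coeff_approx: "coeff (laguerre_approx \<nu> n) m = weight n m * dbessel_coeff \<nu> m"
proof -
  have "coeff (laguerre_approx \<nu> n) m = (1 / (4 * real n)) ^ m * ((2 * real m + \<nu>) * coeff (laguerre n \<nu>) m)"
    by (cases m) (auto simp: laguerre_approx_def coeff_pcompose_linear coeff_pderiv poly_0_coeff_0 algebra_simps)
  then show ?thesis
    by (simp add: coeff_laguerre weight_def dbessel_coeff_def clifford_coeff_def power_divide power_mult_distrib mult_ac)
qed

lemma degree_approx:
  assumes "-1 < \<nu>" "\<nu> < 0" "n \<ge> 1"
  shows "degree (laguerre_approx \<nu> n) = n"
proof (rule antisym)
  show "degree (laguerre_approx \<nu> n) \<le> n"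
    by (rule degree_le) (auto simp: coeff_approx weight_def)
  show "n \<le> degree (laguerre_approx \<nu> n)"
    using assms dbessel_coeff_nz by (intro le_degree) (auto simp: coeff_approx weight_def)
qed

text \<open>Rolle's theorem for \<open>t powr (\<nu> / 2) * laguerre n \<nu> t\<close>, whose derivative is
  \<open>\<nu> + 2 * t * d/dt\<close> applied to the Laguerre polynomial, up to a factor without zeros.\<close>

lemma approx_pos_roots:
  assumes "-1 < \<nu>" "n \<ge> 1"
  shows "\<exists>T. finite T \<and> card T = n - 1 \<and> T \<subseteq> {0<..} \<and> (\<forall>t\<in>T. poly (laguerre_approx \<nu> n) t = 0)"
proof -
  define q where "q = laguerre n \<nu>"
  obtain S where S: "finite S" "card S = n" "S \<subseteq> {0<..}" "\<forall>t\<in>S. poly q t = 0"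
    using laguerre_roots[of \<nu> n] assms unfolding q_def by auto
  define f where "f = (\<lambda>t. t powr (\<nu> / 2) * poly q t)"
  define f' where "f' = (\<lambda>t. t powr (\<nu> / 2) / (2 * t) * (\<nu> * poly q t + 2 * t * poly (pderiv q) t))"
  have "S \<noteq> {}" using S assms by auto
  then have m: "Min S \<in> S" using S by auto
  then have "Min S > 0" using S by auto
  have der: "(f has_real_derivative f' t) (at t)" if "t > 0" for t
  proof -
    have "t powr (\<nu> / 2 - 1) = t powr (\<nu> / 2) / t" using that by (simp add: powr_diff)
    then show ?thesis unfolding f_def f'_def using that
      by (auto intro!: derivative_eq_intros simp: algebra_simps add_divide_distrib)
  qed
  have "\<exists>T. finite T \<and> card T = n - 1 \<and> T \<subseteq> {Min S<..<Max S} \<and> (\<forall>x\<in>T. f' x = 0)"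
  proof (rule rolle_many[of _ _ "Min S" f])
    show "card S = Suc (n - 1)" using S assms by simp
    show "S \<subseteq> {Min S..}" using S by auto
    show "continuous_on {Min S..} f"
      by (rule DERIV_continuous_on[of _ _ f'])
        (use \<open>Min S > 0\<close> in \<open>auto intro!: has_field_derivative_at_within der\<close>)
    show "f x = 0" if "x \<in> S" for x using S(4) that by (auto simp: f_def)
  qed (use S \<open>Min S > 0\<close> der in auto)
  then obtain T where T: "finite T" "card T = n - 1" "T \<subseteq> {Min S<..<Max S}" "\<forall>x\<in>T. f' x = 0"
    by blast
  have pos: "T \<subseteq> {0<..}" using T(3) \<open>Min S > 0\<close> by auto
  have "poly (laguerre_approx \<nu> n) (4 * real n * t) = 0" if "t \<in> T" for t
  proof -
    have "t > 0" "f' t = 0" using that T(4) pos by auto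
    then have "\<nu> * poly q t + 2 * t * poly (pderiv q) t = 0" by (simp add: f'_def)
    then show ?thesis using assms by (simp add: laguerre_approx_def poly_pcompose q_def mult.assoc)
  qed
  then show ?thesis using T(1,2) pos assms
    by (intro exI[of _ "(\<lambda>t. 4 * real n * t) ` T"])
      (auto simp: inj_on_def intro!: card_image[THEN trans])
qed

lemma approx_at_0: "poly (laguerre_approx \<nu> n) 0 = dbessel_coeff \<nu> 0"
  by (simp add: poly_0_coeff_0 coeff_approx weight_def)

text \<open>In powers of \<open>- s\<close> all coefficients but the constant one are nonnegative, so the value at \<open>- K\<close> is
  bounded below by the terms of degree at most \<open>1\<close>.\<close>

lemma approx_neg_root:
  assumes "-1 < \<nu>" "\<nu> < 0" "n \<ge> 1"
  shows "\<exists>r<0. poly (laguerre_approx \<nu> n) r = 0"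
proof -
  \<comment> \<open>The zero of the part of degree at most \<open>1\<close> is \<open>- K\<close>, because \<open>weight n 1 = 1\<close>.\<close>
  define K where "K = - dbessel_coeff \<nu> 0 / (- dbessel_coeff \<nu> 1)"
  have g1: "- dbessel_coeff \<nu> 1 > 0" using dbessel_coeff_sign[of \<nu> 1] assms by simp
  have K: "K > 0" using g1 dbessel_coeff_0_neg[OF assms(1,2)] by (simp add: K_def divide_neg_neg)
  have "poly (laguerre_approx \<nu> n) (- K) = (\<Sum>i\<le>n. weight n i * (dbessel_coeff \<nu> i * (- 1) ^ i * K ^ i))"
    using assms by (simp add: poly_altdef degree_approx coeff_approx power_minus[of K] mult_ac)
  also have "\<dots> \<ge> (\<Sum>i\<in>{0,1}. weight n i * (dbessel_coeff \<nu> i * (- 1) ^ i * K ^ i))"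
  proof (rule sum_mono2)
    fix i assume "i \<in> {..n} - {0, 1}"
    then have "0 \<le> dbessel_coeff \<nu> i * (- 1) ^ i * K ^ i"
      using assms K dbessel_coeff_sign[of \<nu> i] by simp
    then show "0 \<le> weight n i * (dbessel_coeff \<nu> i * (- 1) ^ i * K ^ i)"
      using weight_bounds(1) by (rule mult_nonneg_nonneg[rotated])
  qed (use assms in auto)
  finally have "poly (laguerre_approx \<nu> n) (- K) \<ge> dbessel_coeff \<nu> 0 + weight n 1 * (- dbessel_coeff \<nu> 1) * K"
    using assms by (simp add: weight_def split: if_splits)
  moreover have "weight n 1 * (- dbessel_coeff \<nu> 1) * K = - dbessel_coeff \<nu> 0"
    using assms g1 by (simp add: weight_def K_def)
  ultimately have "poly (laguerre_approx \<nu> n) (- K) \<ge> 0" by simp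
  moreover have "continuous_on {- K..0} (poly (laguerre_approx \<nu> n))" by (intro continuous_intros)
  ultimately obtain r where "- K \<le> r" "r \<le> 0" "poly (laguerre_approx \<nu> n) r = 0"
    using IVT2'[of "poly (laguerre_approx \<nu> n)" 0 0 "- K"] K dbessel_coeff_0_neg[of \<nu>] assms
    by (auto simp: approx_at_0)
  moreover have "r \<noteq> 0" using calculation dbessel_coeff_0_neg[of \<nu>] assms by (auto simp: approx_at_0)
  ultimately show ?thesis by (intro exI[of _ r]) auto
qed

lemma roots_of_approx:
  assumes "-1 < \<nu>" "\<nu> < 0" "n \<ge> 1"
  shows "\<exists>r T. r < 0 \<and> finite T \<and> T \<subseteq> {0<..} \<and> {x. poly (laguerre_approx \<nu> n) x = 0} = insert r T
    \<and> card (insert r T) = degree (laguerre_approx \<nu> n)"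
proof -
  obtain T where T: "finite T" "card T = n - 1" "T \<subseteq> {0<..}" "\<forall>t\<in>T. poly (laguerre_approx \<nu> n) t = 0"
    using approx_pos_roots assms by blast
  obtain r where r: "r < 0" "poly (laguerre_approx \<nu> n) r = 0" using approx_neg_root assms by blast
  have "r \<notin> T" using r T by auto
  then have card: "card (insert r T) = n" using T assms by simp
  have nz: "laguerre_approx \<nu> n \<noteq> 0" using degree_approx[OF assms] assms by force
  have "insert r T = {x. poly (laguerre_approx \<nu> n) x = 0}"
  proof (rule card_seteq)
    show "card {x. poly (laguerre_approx \<nu> n) x = 0} \<le> card (insert r T)"
      using card_poly_roots_bound[OF nz] card degree_approx[OF assms] by simp
  qed (use nz T r poly_roots_finite in auto)
  with r T card degree_approx[OF assms] show ?thesis by (intro exI[of _ r] exI[of _ T]) auto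
qed

lemma poly_suminf: "poly p (x::real) = (\<Sum>m. coeff p m * x ^ m)"
  proof -
  have "(\<Sum>m. coeff p m * x ^ m) = (\<Sum>m\<le>degree p. coeff p m * x ^ m)"
    by (rule suminf_finite) (auto simp: coeff_eq_0)
  then show ?thesis by (simp add: poly_altdef)
qed

text \<open>On a bounded interval the difference is dominated by a series with the factors \<open>1 - w n m\<close>,
  which does not depend on the point; Tannery's theorem shows that it tends to \<open>0\<close>.\<close>

lemma uniform_limit_weighted_power_series:
  fixes p :: "nat \<Rightarrow> real poly"
  assumes summ: "\<And>x. summable (\<lambda>m. d m * x ^ m)"
    and coeff: "\<And>n m. coeff (p n) m = w n m * d m"
    and w: "\<And>n m. 0 \<le> w n m" "\<And>n m. w n m \<le> 1" "\<And>m. (\<lambda>n. w n m) \<longlonglongrightarrow> 1"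
  shows "uniform_limit {a..b} (\<lambda>n. poly (p n)) (\<lambda>s. \<Sum>m. d m * s ^ m) sequentially"
proof (rule uniform_limitI)
  define R where "R = max \<bar>a\<bar> \<bar>b\<bar>"
  have "R \<ge> 0" by (auto simp: R_def)
  define M where "M = (\<lambda>m. \<bar>d m\<bar> * R ^ m)"
  have M: "summable M" "\<And>m. M m \<ge> 0"
    using powser_insidea[OF summ[of "R + 1"], of R] \<open>R \<ge> 0\<close>
    by (simp_all add: M_def abs_mult power_abs)
  define \<delta> where "\<delta> = (\<lambda>n. \<Sum>m. (1 - w n m) * M m)"
  have le: "\<bar>(1 - w n m) * M m\<bar> \<le> M m" for n m
    using w M mult_right_mono[of "1 - w n m" 1 "M m"] by (simp add: abs_mult)
  have sm: "summable (\<lambda>m. (1 - w n m) * M m)" for n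
    by (rule summable_comparison_test[OF _ M(1)]) (use le in auto)
  have "(\<lambda>n. \<Sum>m. (1 - w n m) * M m) \<longlonglongrightarrow> (\<Sum>m. (1 - 1) * M m)"
  proof (rule tannerys_theorem[where M = M, THEN conjunct2, THEN conjunct2])
    show "(\<lambda>n. (1 - w n m) * M m) \<longlonglongrightarrow> (1 - 1) * M m" for m by (intro tendsto_intros w(3))
  qed (use le M(1) in \<open>auto simp: eventually_prod_sequentially\<close>)
  then have "\<delta> \<longlonglongrightarrow> 0" by (simp add: \<delta>_def)
  fix e :: real assume "e > 0"
  with \<open>\<delta> \<longlonglongrightarrow> 0\<close> have "\<forall>\<^sub>F n in sequentially. \<delta> n < e" by (rule order_tendstoD)
  then show "\<forall>\<^sub>F n in sequentially. \<forall>s\<in>{a..b}. dist (poly (p n) s) (\<Sum>m. d m * s ^ m) < e"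
  proof (rule eventually_mono, intro ballI)
    fix n s assume n: "\<delta> n < e" and s: "s \<in> {a..b}"
    have sR: "\<bar>s\<bar> \<le> R" using s by (auto simp: R_def)
    have t: "(w n m * d m - d m) * s ^ m = - ((1 - w n m) * (d m * s ^ m))" for m
      by (simp add: algebra_simps)
    have bound: "norm ((w n m * d m - d m) * s ^ m) \<le> (1 - w n m) * M m" for m
    proof -
      have "\<bar>d m\<bar> * \<bar>s\<bar> ^ m \<le> M m"
        unfolding M_def using sR by (intro mult_left_mono power_mono) auto
      then have "(1 - w n m) * (\<bar>d m\<bar> * \<bar>s\<bar> ^ m) \<le> (1 - w n m) * M m"
        using w by (intro mult_left_mono) auto
      then show ?thesis unfolding t using w(2)[of n m] by (simp add: abs_mult power_abs)
    qed
    have "summable (\<lambda>m. (w n m * d m - d m) * s ^ m)"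
      by (rule summable_comparison_test[OF _ sm[of n]]) (use bound in auto)
    from summable_add[OF this summ[of s]]
    have "summable (\<lambda>m. w n m * d m * s ^ m)" by (simp add: algebra_simps)
    from suminf_diff[OF this summ[of s]]
    have "poly (p n) s - (\<Sum>m. d m * s ^ m) = (\<Sum>m. (w n m * d m - d m) * s ^ m)"
      by (simp add: poly_suminf coeff algebra_simps)
    moreover have "norm (\<Sum>m. (w n m * d m - d m) * s ^ m) \<le> \<delta> n"
      unfolding \<delta>_def by (rule norm_suminf_le[OF bound sm])
    ultimately show "dist (poly (p n) s) (\<Sum>m. d m * s ^ m) < e" using n by (simp add: dist_real_def)
  qed
qed

lemma approx_uniform_limit:
  assumes "-1 < \<nu>"
  shows "uniform_limit {a..b} (\<lambda>n. poly (laguerre_approx \<nu> n)) (dbessel \<nu>) sequentially"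
    and "uniform_limit {a..b} (\<lambda>n. poly (pderiv (laguerre_approx \<nu> n))) (dbessel' \<nu>) sequentially"
proof -
  show "uniform_limit {a..b} (\<lambda>n. poly (laguerre_approx \<nu> n)) (dbessel \<nu>) sequentially"
    unfolding dbessel_def[abs_def]
    by (rule uniform_limit_weighted_power_series[where w = weight])
      (auto simp: summable_dbessel assms coeff_approx weight_bounds weight_tendsto_1)
  have "summable (\<lambda>m. diffs (dbessel_coeff \<nu>) m * x ^ m)" for x
    by (rule termdiff_converges_all) (rule summable_dbessel[OF assms])
  then show "uniform_limit {a..b} (\<lambda>n. poly (pderiv (laguerre_approx \<nu> n))) (dbessel' \<nu>) sequentially"
    unfolding dbessel'_def[abs_def]
    by (rule uniform_limit_weighted_power_series[where w = "\<lambda>n m. weight n (Suc m)"])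
      (auto simp: coeff_pderiv coeff_approx weight_bounds weight_tendsto_1 diffs_def[of "dbessel_coeff \<nu>"])
qed

definition approx_roots :: "real \<Rightarrow> nat \<Rightarrow> real set" where
  "approx_roots \<nu> n = {x. poly (laguerre_approx \<nu> n) x = 0}"

definition summand :: "real \<Rightarrow> real \<Rightarrow> real" where
  "summand \<nu> z = 1 / ((z - \<nu>\<^sup>2) * z)"

context
  fixes \<nu> :: real
  assumes nu: "-1 < \<nu>" "\<nu> < 0"
begin

lemma finite_approx_roots: "n \<ge> 1 \<Longrightarrow> finite (approx_roots \<nu> n)"
  using roots_of_approx[OF nu, of n] by (auto simp: approx_roots_def)

lemma nu_sq: "\<nu>\<^sup>2 < 1" "\<nu>\<^sup>2 > 0" "dbessel \<nu> (\<nu>\<^sup>2) < 0"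
  using nu dbessel_neg[OF nu, of "\<nu>\<^sup>2"] by (auto simp: abs_square_less_1 abs_square_le_1)

lemma approx_log_deriv:
  assumes "n \<ge> 1" "poly (laguerre_approx \<nu> n) x \<noteq> 0"
  shows "(\<Sum>r\<in>approx_roots \<nu> n. 1 / (x - r)) = poly (pderiv (laguerre_approx \<nu> n)) x / poly (laguerre_approx \<nu> n) x"
proof (rule poly_log_deriv[symmetric])
  obtain r T where rT: "finite T" "{x. poly (laguerre_approx \<nu> n) x = 0} = insert r T"
    "card (insert r T) = degree (laguerre_approx \<nu> n)"
    using roots_of_approx[OF nu assms(1)] by blast
  then show "finite (approx_roots \<nu> n)" "card (approx_roots \<nu> n) = degree (laguerre_approx \<nu> n)" by (simp_all add: approx_roots_def)
qed (use assms in \<open>auto simp: approx_roots_def\<close>)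

lemma sum_reciprocal_roots:
  assumes "n \<ge> 1"
  shows "(\<Sum>r\<in>approx_roots \<nu> n. 1 / r) = - (dbessel_coeff \<nu> 1 / dbessel_coeff \<nu> 0)"
proof -
  have "poly (pderiv (laguerre_approx \<nu> n)) 0 = dbessel_coeff \<nu> 1"
    using assms by (simp add: poly_0_coeff_0 coeff_pderiv coeff_approx weight_def)
  then have "(\<Sum>r\<in>approx_roots \<nu> n. 1 / (0 - r)) = dbessel_coeff \<nu> 1 / dbessel_coeff \<nu> 0"
    using approx_log_deriv[OF assms, of 0] dbessel_coeff_0_neg[OF nu] by (simp add: approx_at_0)
  moreover have "(\<Sum>r\<in>approx_roots \<nu> n. 1 / (0 - r)) = - (\<Sum>r\<in>approx_roots \<nu> n. 1 / r)"
    by (simp add: sum_negf)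
  ultimately show ?thesis by simp
qed

text \<open>The signed sum of the reciprocals is a constant by \<open>sum_reciprocal_roots\<close>. It differs from the
  absolute one only in the negative root, which stays away from \<open>0\<close> because \<open>dbessel \<nu>\<close> has no
  zero in a left neighbourhood of \<open>0\<close>.\<close>

lemma sum_abs_reciprocal_roots_bounded:
  "\<exists>C>0. \<forall>\<^sub>F n in sequentially. (\<Sum>r\<in>approx_roots \<nu> n. 1 / \<bar>r\<bar>) \<le> C"
proof -
  obtain z0 where z0: "z0 < 0" "dbessel \<nu> z0 = 0" "\<And>z. z < 0 \<Longrightarrow> dbessel \<nu> z = 0 \<Longrightarrow> z = z0"
    using dbessel_neg_zero[OF nu] by blast
  \<comment> \<open>Any \<open>d\<close> with \<open>z0 < - d < 0\<close> would do.\<close>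
  define d where "d = - z0 / 2"
  have d: "d > 0" using z0(1) by (simp add: d_def)
  have no_root: "\<forall>\<^sub>F n in sequentially. \<forall>x\<in>{- d..0}. poly (laguerre_approx \<nu> n) x \<noteq> 0"
  proof (rule uniform_limit_nonvanishing[OF approx_uniform_limit(1)[OF nu(1)]])
    show "continuous_on {- d..0} (dbessel \<nu>)"
      by (rule DERIV_continuous_on[OF has_field_derivative_at_within[OF DERIV_dbessel[OF nu(1)]]])
    fix x assume x: "x \<in> {- d..0}"
    show "dbessel \<nu> x \<noteq> 0"
    proof (cases "x = 0")
      case True
      then show ?thesis using dbessel_coeff_0_neg[OF nu] by (simp add: dbessel_at_0)
    next
      case False
      then have "x < 0" "x \<noteq> z0" using x z0(1) by (auto simp: d_def)
      then show ?thesis using z0(3) by blast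
    qed
  qed auto
  define C where "C = max 1 (- (dbessel_coeff \<nu> 1 / dbessel_coeff \<nu> 0) + 2 / d)"
  have "\<forall>\<^sub>F n in sequentially. (\<Sum>r\<in>approx_roots \<nu> n. 1 / \<bar>r\<bar>) \<le> C"
    using no_root eventually_ge_at_top[of 1]
  proof eventually_elim
    case (elim n)
    obtain r T where rT: "r < 0" "finite T" "T \<subseteq> {0<..}" "approx_roots \<nu> n = insert r T"
      unfolding approx_roots_def using roots_of_approx[OF nu elim(2)] by blast
    have "r \<notin> T" using rT by auto
    have "r \<in> approx_roots \<nu> n" using rT by simp
    then have "r < - d" using elim(1) rT(1) by (force simp: approx_roots_def)
    then have "- (1 / r) \<le> 1 / d" using d rT(1) by (simp add: field_simps)
    have "(\<Sum>t\<in>T. 1 / \<bar>t\<bar>) = (\<Sum>t\<in>T. 1 / t)"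
      using rT(3) by (intro sum.cong) auto
    then have "(\<Sum>r\<in>approx_roots \<nu> n. 1 / \<bar>r\<bar>) = (\<Sum>r\<in>approx_roots \<nu> n. 1 / r) - 2 * (1 / r)"
      using rT \<open>r \<notin> T\<close> by (simp add: field_simps)
    also have "\<dots> \<le> - (dbessel_coeff \<nu> 1 / dbessel_coeff \<nu> 0) + 2 / d"
      using sum_reciprocal_roots[OF elim(2)] \<open>- (1 / r) \<le> 1 / d\<close> by simp
    finally show ?case by (simp add: C_def)
  qed
  then show ?thesis by (intro exI[of _ C]) (auto simp: C_def)
qed

lemma log_derivs:
  "dbessel' \<nu> (\<nu>\<^sup>2) / dbessel \<nu> (\<nu>\<^sup>2) = - 1 / (2 * \<nu>)"
  "dbessel_coeff \<nu> 1 / dbessel_coeff \<nu> 0 = - (\<nu> + 2) / (4 * \<nu> * (\<nu> + 1))"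
proof -
  have "\<nu> * (2 * \<nu> * dbessel' \<nu> (\<nu>\<^sup>2) + dbessel \<nu> (\<nu>\<^sup>2)) = 0"
    using dbessel_ode[OF nu(1), of "\<nu>\<^sup>2"] by (simp add: algebra_simps power2_eq_square)
  then have "2 * \<nu> * dbessel' \<nu> (\<nu>\<^sup>2) = - dbessel \<nu> (\<nu>\<^sup>2)" using nu by simp
  then show "dbessel' \<nu> (\<nu>\<^sup>2) / dbessel \<nu> (\<nu>\<^sup>2) = - 1 / (2 * \<nu>)"
    using nu_sq(3) nu by (simp add: field_simps)
  define b where "b = clifford_coeff \<nu> 1"
  have b0: "clifford_coeff \<nu> 0 = - (4 * (1 + \<nu>) * b)" using clifford_coeff_Suc[of 0 \<nu>] by (simp add: b_def)
  have g: "dbessel_coeff \<nu> 1 = (\<nu> + 2) * b" "dbessel_coeff \<nu> 0 = - (4 * \<nu> * (\<nu> + 1) * b)"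
    by (simp_all add: dbessel_coeff_def b_def[symmetric] b0 algebra_simps del: One_nat_def)
  have "b \<noteq> 0" using dbessel_coeff_nz[OF nu, of 1] unfolding g by auto
  then show "dbessel_coeff \<nu> 1 / dbessel_coeff \<nu> 0 = - (\<nu> + 2) / (4 * \<nu> * (\<nu> + 1))"
    unfolding g using nu by (simp add: divide_simps)
qed

text \<open>Partial fractions reduce the sum to the logarithmic derivatives of \<open>laguerre_approx \<nu> n\<close> at \<open>0\<close>
  and at \<open>\<nu>\<^sup>2\<close>, which converge to those of \<open>dbessel \<nu>\<close>.\<close>

lemma sum_over_roots_limit:
  "(\<lambda>n. \<Sum>r\<in>approx_roots \<nu> n. summand \<nu> r) \<longlonglongrightarrow> 1 / (4 * \<nu>\<^sup>2 * (\<nu> + 1))"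
proof -
  have lim: "(\<lambda>n. poly (laguerre_approx \<nu> n) (\<nu>\<^sup>2)) \<longlonglongrightarrow> dbessel \<nu> (\<nu>\<^sup>2)"
    "(\<lambda>n. poly (pderiv (laguerre_approx \<nu> n)) (\<nu>\<^sup>2)) \<longlonglongrightarrow> dbessel' \<nu> (\<nu>\<^sup>2)"
    using approx_uniform_limit[OF nu(1), of 0 "\<nu>\<^sup>2"] by (auto intro: tendsto_uniform_limitI)
  have "(\<lambda>n. 1 / \<nu>\<^sup>2 * (dbessel_coeff \<nu> 1 / dbessel_coeff \<nu> 0
      - poly (pderiv (laguerre_approx \<nu> n)) (\<nu>\<^sup>2) / poly (laguerre_approx \<nu> n) (\<nu>\<^sup>2)))
    \<longlonglongrightarrow> 1 / \<nu>\<^sup>2 * (dbessel_coeff \<nu> 1 / dbessel_coeff \<nu> 0 - dbessel' \<nu> (\<nu>\<^sup>2) / dbessel \<nu> (\<nu>\<^sup>2))"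
    using nu_sq by (intro tendsto_intros lim) auto
  moreover have "1 / \<nu>\<^sup>2 * (dbessel_coeff \<nu> 1 / dbessel_coeff \<nu> 0 - dbessel' \<nu> (\<nu>\<^sup>2) / dbessel \<nu> (\<nu>\<^sup>2))
      = 1 / (4 * \<nu>\<^sup>2 * (\<nu> + 1))"
    unfolding log_derivs using nu by (simp add: divide_simps)
  moreover have "\<forall>\<^sub>F n in sequentially. 1 / \<nu>\<^sup>2 * (dbessel_coeff \<nu> 1 / dbessel_coeff \<nu> 0
      - poly (pderiv (laguerre_approx \<nu> n)) (\<nu>\<^sup>2) / poly (laguerre_approx \<nu> n) (\<nu>\<^sup>2))
    = (\<Sum>r\<in>approx_roots \<nu> n. summand \<nu> r)"
    using order_tendstoD(2)[OF lim(1) nu_sq(3)] eventually_ge_at_top[of 1]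
  proof eventually_elim
    case (elim n)
    then have nz: "poly (laguerre_approx \<nu> n) (\<nu>\<^sup>2) \<noteq> 0" by simp
    have "summand \<nu> r = 1 / \<nu>\<^sup>2 * (- (1 / r) - 1 / (\<nu>\<^sup>2 - r))" if "r \<in> approx_roots \<nu> n" for r
    proof -
      have "r \<noteq> \<nu>\<^sup>2" "r \<noteq> 0"
        using that nz dbessel_coeff_0_neg[OF nu] by (auto simp: approx_roots_def approx_at_0)
      then show ?thesis using nu by (simp add: summand_def divide_simps)
    qed
    then have "(\<Sum>r\<in>approx_roots \<nu> n. summand \<nu> r)
        = 1 / \<nu>\<^sup>2 * (- (\<Sum>r\<in>approx_roots \<nu> n. 1 / r) - (\<Sum>r\<in>approx_roots \<nu> n. 1 / (\<nu>\<^sup>2 - r)))"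
      by (simp only: sum.cong[OF refl, of "approx_roots \<nu> n" "summand \<nu>"]
          sum_distrib_left[symmetric] sum_subtractf sum_negf)
    then show ?case
      using sum_reciprocal_roots[OF elim(2)] approx_log_deriv[OF elim(2) nz] by simp
  qed
  ultimately show ?thesis using Lim_transform_eventually by fastforce
qed

lemma summand_bounds:
  assumes "R > 1" "\<bar>r\<bar> > R"
  shows "0 \<le> summand \<nu> r" "summand \<nu> r \<le> 1 / (R - 1) * (1 / \<bar>r\<bar>)"
proof -
  have "(R - 1) * \<bar>r\<bar> \<le> (r - \<nu>\<^sup>2) * r"
  proof (cases "r > 0")
    case True
    then show ?thesis using assms nu_sq by (intro mult_mono) auto
  next
    case False
    then have "(R - 1) * (- r) \<le> (\<nu>\<^sup>2 - r) * (- r)"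
      using assms nu_sq(2) by (intro mult_right_mono) linarith+
    then show ?thesis using False by (simp add: algebra_simps)
  qed
  moreover have "(R - 1) * \<bar>r\<bar> > 0" using assms by simp
  ultimately show "0 \<le> summand \<nu> r" "summand \<nu> r \<le> 1 / (R - 1) * (1 / \<bar>r\<bar>)"
    unfolding summand_def by (auto simp: frac_le)
qed

lemma summand_nonneg:
  assumes "dbessel \<nu> z = 0"
  shows "0 \<le> summand \<nu> z"
proof (cases "z < 0")
  case True
  then have "z - \<nu>\<^sup>2 \<le> 0" using nu_sq(2) by linarith
  with True have "(z - \<nu>\<^sup>2) * z \<ge> 0" by (intro mult_nonpos_nonpos) auto
  then show ?thesis by (simp add: summand_def)
next
  case False
  then have "z > 1" using dbessel_neg[OF nu, of z] assms by force
  then show ?thesis using nu_sq by (simp add: summand_def)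
qed

text \<open>The sum over the roots in \<open>{-R..R}\<close> converges to \<open>S\<close>. The roots outside contribute a nonnegative
  amount of at most \<open>C / (R - 1)\<close>, since there the summand is at most \<open>1 / ((R - 1) * \<bar>r\<bar>)\<close>.\<close>

lemma sum_over_zeros_bounds:
  assumes C: "C > 0" "\<forall>\<^sub>F n in sequentially. (\<Sum>r\<in>approx_roots \<nu> n. 1 / \<bar>r\<bar>) \<le> C"
    and R: "R > 1" "dbessel \<nu> R \<noteq> 0" "dbessel \<nu> (- R) \<noteq> 0"
  defines "S \<equiv> (\<Sum>z | z \<in> {-R..R} \<and> dbessel \<nu> z = 0. summand \<nu> z)"
  shows "S \<le> 1 / (4 * \<nu>\<^sup>2 * (\<nu> + 1))" "1 / (4 * \<nu>\<^sup>2 * (\<nu> + 1)) \<le> S + C / (R - 1)"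
proof -
  have lim: "(\<lambda>n. \<Sum>r | r \<in> {-R..R} \<and> poly (laguerre_approx \<nu> n) r = 0. summand \<nu> r) \<longlonglongrightarrow> S"
    unfolding S_def
  proof (rule sum_over_roots_tendsto[where g' = "dbessel' \<nu>" and p' = "\<lambda>n. poly (pderiv (laguerre_approx \<nu> n))"])
    show "finite {z \<in> {-R..R}. dbessel \<nu> z = 0}" by (rule dbessel_finite_zeros[OF nu])
    fix z assume "z \<in> {z \<in> {-R..R}. dbessel \<nu> z = 0}"
    then have z: "dbessel \<nu> z = 0" by simp
    then show "dbessel' \<nu> z \<noteq> 0" by (rule dbessel_simple_zeros[OF nu])
    have "z \<noteq> 0" "z \<noteq> \<nu>\<^sup>2" using z nu_sq dbessel_coeff_0_neg[OF nu] by (auto simp: dbessel_at_0)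
    then show "isCont (summand \<nu>) z"
      unfolding summand_def[abs_def] by (intro continuous_intros) auto
  qed (use R in \<open>auto intro!: DERIV_dbessel continuous_dbessel' poly_DERIV approx_uniform_limit nu\<close>)
  have split: "(\<Sum>r | r \<in> {-R..R} \<and> poly (laguerre_approx \<nu> n) r = 0. summand \<nu> r)
      + (\<Sum>r\<in>approx_roots \<nu> n - {-R..R}. summand \<nu> r) = (\<Sum>r\<in>approx_roots \<nu> n. summand \<nu> r)" if "n \<ge> 1" for n
  proof -
    have "{r. r \<in> {-R..R} \<and> poly (laguerre_approx \<nu> n) r = 0} = approx_roots \<nu> n \<inter> {-R..R}" by (auto simp: approx_roots_def)
    then show ?thesis using sum.Int_Diff[OF finite_approx_roots[OF that], of "summand \<nu>" "{-R..R}"] by simp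
  qed
  have out: "\<bar>r\<bar> > R" if "r \<in> approx_roots \<nu> n - {-R..R}" for r n using that by auto
  show "S \<le> 1 / (4 * \<nu>\<^sup>2 * (\<nu> + 1))"
  proof (rule tendsto_le[OF _ sum_over_roots_limit lim])
    show "\<forall>\<^sub>F n in sequentially. (\<Sum>r | r \<in> {-R..R} \<and> poly (laguerre_approx \<nu> n) r = 0. summand \<nu> r)
      \<le> (\<Sum>r\<in>approx_roots \<nu> n. summand \<nu> r)"
      using eventually_ge_at_top[of 1]
    proof eventually_elim
      case (elim n)
      have "(\<Sum>r\<in>approx_roots \<nu> n - {-R..R}. summand \<nu> r) \<ge> 0"
        by (intro sum_nonneg summand_bounds(1)[OF R(1) out])
      then show ?case using split[OF elim] by simp
    qed
  qed simp
  have lim': "(\<lambda>n. (\<Sum>r | r \<in> {-R..R} \<and> poly (laguerre_approx \<nu> n) r = 0. summand \<nu> r) + C / (R - 1))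
      \<longlonglongrightarrow> S + C / (R - 1)"
    by (intro tendsto_intros lim)
  show "1 / (4 * \<nu>\<^sup>2 * (\<nu> + 1)) \<le> S + C / (R - 1)"
  proof (rule tendsto_le[OF _ lim' sum_over_roots_limit])
    show "\<forall>\<^sub>F n in sequentially. (\<Sum>r\<in>approx_roots \<nu> n. summand \<nu> r) \<le>
        (\<Sum>r | r \<in> {-R..R} \<and> poly (laguerre_approx \<nu> n) r = 0. summand \<nu> r) + C / (R - 1)"
      using eventually_ge_at_top[of 1] C(2)
    proof eventually_elim
      case (elim n)
      have "(\<Sum>r\<in>approx_roots \<nu> n - {-R..R}. summand \<nu> r)
          \<le> (\<Sum>r\<in>approx_roots \<nu> n - {-R..R}. 1 / (R - 1) * (1 / \<bar>r\<bar>))"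
        by (intro sum_mono summand_bounds(2)[OF R(1) out])
      also have "\<dots> \<le> (\<Sum>r\<in>approx_roots \<nu> n. 1 / (R - 1) * (1 / \<bar>r\<bar>))"
        using R by (intro sum_mono2 finite_approx_roots elim) auto
      also have "\<dots> = 1 / (R - 1) * (\<Sum>r\<in>approx_roots \<nu> n. 1 / \<bar>r\<bar>)" by (rule sum_distrib_left[symmetric])
      also have "\<dots> \<le> 1 / (R - 1) * C" using R elim by (intro mult_left_mono) auto
      finally show ?case using split[OF elim(1)] by simp
    qed
  qed simp
qed

lemma has_sum_over_dbessel_zeros:
  "(summand \<nu> has_sum 1 / (4 * \<nu>\<^sup>2 * (\<nu> + 1))) {z. dbessel \<nu> z = 0}"
proof -
  define L where "L = 1 / (4 * \<nu>\<^sup>2 * (\<nu> + 1))"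
  define Z where "Z = (\<lambda>R. {z. z \<in> {-R..R} \<and> dbessel \<nu> z = 0})"
  have finZ: "finite (Z R)" for R unfolding Z_def by (rule dbessel_finite_zeros[OF nu])
  obtain C where C: "C > 0" "\<forall>\<^sub>F n in sequentially. (\<Sum>r\<in>approx_roots \<nu> n. 1 / \<bar>r\<bar>) \<le> C"
    using sum_abs_reciprocal_roots_bounded by blast
  have good: "\<exists>R>M. dbessel \<nu> R \<noteq> 0 \<and> dbessel \<nu> (- R) \<noteq> 0" if "M > 0" for M
  proof -
    \<comment> \<open>The zeros are finite in number on bounded sets, so \<open>R\<close> can be chosen
      with \<open>R\<close> and \<open>- R\<close> off the zeros.\<close>
    have "finite (abs ` Z (M + 1))" using finZ by blast
    moreover have "infinite {M<..<M + 1}" by (simp add: infinite_Ioo)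
    ultimately obtain R where "R \<in> {M<..<M + 1}" "R \<notin> abs ` Z (M + 1)"
      by (meson finite_subset subsetI)
    then have R: "R > M" "R \<notin> Z (M + 1)" "- R \<notin> Z (M + 1)" "R \<in> {-(M+1)..M+1}" "-R \<in> {-(M+1)..M+1}"
      using that by (auto simp: image_iff)
    then show ?thesis unfolding Z_def by blast
  qed
  have upper: "sum (summand \<nu>) Y \<le> L" if Y: "finite Y" "Y \<subseteq> {z. dbessel \<nu> z = 0}" for Y
  proof -
    define M where "M = Max (insert 1 (abs ` Y))"
    have M: "M \<ge> 1" "\<And>y. y \<in> Y \<Longrightarrow> \<bar>y\<bar> \<le> M" using Y by (auto simp: M_def)
    then obtain R where R: "R > M" "dbessel \<nu> R \<noteq> 0" "dbessel \<nu> (- R) \<noteq> 0" using good[of M] by auto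
    have "Y \<subseteq> Z R" using Y M R unfolding Z_def by (fastforce simp: abs_le_iff)
    then have "sum (summand \<nu>) Y \<le> sum (summand \<nu>) (Z R)"
      using finZ by (intro sum_mono2) (auto simp: Z_def intro: summand_nonneg)
    also have "\<dots> \<le> L" using sum_over_zeros_bounds(1)[OF C] R M by (simp add: Z_def L_def)
    finally show ?thesis .
  qed
  have "(sum (summand \<nu>) \<longlongrightarrow> L) (finite_subsets_at_top {z. dbessel \<nu> z = 0})"
  proof (rule tendstoI)
    fix e :: real assume e: "e > 0"
    obtain R where R: "R > C / e + 1" "dbessel \<nu> R \<noteq> 0" "dbessel \<nu> (- R) \<noteq> 0"
      using good[of "C / e + 1"] C e by (auto simp: add_pos_pos)
    have "C / e > 0" using C e by simp
    then have R1: "R > 1" using R by simp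
    have "C / (R - 1) < e" using R(1) R1 e C by (simp add: field_simps)
    have "\<forall>Y. finite Y \<and> Z R \<subseteq> Y \<and> Y \<subseteq> {z. dbessel \<nu> z = 0} \<longrightarrow> dist (sum (summand \<nu>) Y) L < e"
    proof (intro allI impI)
      fix Y assume Y: "finite Y \<and> Z R \<subseteq> Y \<and> Y \<subseteq> {z. dbessel \<nu> z = 0}"
      have "sum (summand \<nu>) (Z R) \<le> sum (summand \<nu>) Y"
        using Y by (intro sum_mono2) (auto intro: summand_nonneg)
      moreover have "L \<le> sum (summand \<nu>) (Z R) + C / (R - 1)"
        using sum_over_zeros_bounds(2)[OF C R1 R(2,3)] by (simp add: Z_def L_def)
      ultimately show "dist (sum (summand \<nu>) Y) L < e"
        using upper[of Y] Y \<open>C / (R - 1) < e\<close> by (simp add: dist_real_def)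
    qed
    then show "\<forall>\<^sub>F Y in finite_subsets_at_top {z. dbessel \<nu> z = 0}. dist (sum (summand \<nu>) Y) L < e"
      unfolding eventually_finite_subsets_at_top
      using finZ[of R] by (intro exI[of _ "Z R"]) (auto simp: Z_def)
  qed
  then show ?thesis by (simp add: has_sum_def L_def)
qed

end

section \<open>The zeros of the derivatives of the Bessel functions\<close>

lemma half_power: "(x / 2) ^ (2 * m) = (x\<^sup>2) ^ m / (4::real) ^ m"
proof -
  have "(x / 2) ^ (2 * m) = ((x / 2)\<^sup>2) ^ m" by (rule power_mult)
  also have "(x / 2)\<^sup>2 = x\<^sup>2 / 4" by (simp add: power_divide)
  finally show ?thesis by (simp only: power_divide)
qed

context
  fixes \<nu> :: real
  assumes nu: "-1 < \<nu>" "\<nu> < 0"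
begin

lemma bessel_J_eq: "bessel_J \<nu> x = (x / 2) powr \<nu> * clifford \<nu> (x\<^sup>2)"
proof -
  have "(- 1) ^ m * rGamma (real m + \<nu> + 1) / fact m * (x / 2) ^ (2 * m) = clifford_coeff \<nu> m * (x\<^sup>2) ^ m" for m
    unfolding half_power by (simp add: clifford_coeff_def mult_ac)
  then show ?thesis unfolding bessel_J_def clifford_def by presburger
qed

lemma bessel_I_eq: "bessel_I \<nu> x = (x / 2) powr \<nu> * clifford \<nu> (- x\<^sup>2)"
proof -
  have "rGamma (real m + \<nu> + 1) / fact m * (x / 2) ^ (2 * m) = clifford_coeff \<nu> m * (- x\<^sup>2) ^ m" for m
    unfolding power_minus[of "x\<^sup>2"] half_power
    by (cases "even m") (simp_all add: clifford_coeff_def mult_ac)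
  then show ?thesis unfolding bessel_I_def clifford_def by presburger
qed

lemma deriv_bessel:
  assumes "x > 0"
  shows "deriv (bessel_J \<nu>) x = (x / 2) powr \<nu> / x * dbessel \<nu> (x\<^sup>2)"
    and "deriv (bessel_I \<nu>) x = (x / 2) powr \<nu> / x * dbessel \<nu> (- x\<^sup>2)"
proof -
  have p: "((\<lambda>x. (x / 2) powr \<nu>) has_real_derivative \<nu> * ((x / 2) powr \<nu> / x)) (at x)"
    using assms by (auto intro!: derivative_eq_intros simp: powr_diff)
  have "((\<lambda>x. (x / 2) powr \<nu> * clifford \<nu> (x\<^sup>2)) has_real_derivative
      \<nu> * ((x / 2) powr \<nu> / x) * clifford \<nu> (x\<^sup>2) + clifford' \<nu> (x\<^sup>2) * (2 * x) * (x / 2) powr \<nu>) (at x)"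
    by (rule DERIV_mult[OF p DERIV_chain2[OF DERIV_clifford[OF nu(1)]]]) (auto intro!: derivative_eq_intros)
  then have "(bessel_J \<nu> has_real_derivative
      \<nu> * ((x / 2) powr \<nu> / x) * clifford \<nu> (x\<^sup>2) + clifford' \<nu> (x\<^sup>2) * (2 * x) * (x / 2) powr \<nu>) (at x)"
    by (simp add: bessel_J_eq[abs_def])
  then show "deriv (bessel_J \<nu>) x = (x / 2) powr \<nu> / x * dbessel \<nu> (x\<^sup>2)"
    using assms by (simp add: DERIV_imp_deriv dbessel_eq[OF nu(1)] field_simps power2_eq_square)
  have "((\<lambda>x. (x / 2) powr \<nu> * clifford \<nu> (- x\<^sup>2)) has_real_derivative
      \<nu> * ((x / 2) powr \<nu> / x) * clifford \<nu> (- x\<^sup>2) + clifford' \<nu> (- x\<^sup>2) * - (2 * x) * (x / 2) powr \<nu>) (at x)"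
    by (rule DERIV_mult[OF p DERIV_chain2[OF DERIV_clifford[OF nu(1)]]]) (auto intro!: derivative_eq_intros)
  then have "(bessel_I \<nu> has_real_derivative
      \<nu> * ((x / 2) powr \<nu> / x) * clifford \<nu> (- x\<^sup>2) + clifford' \<nu> (- x\<^sup>2) * - (2 * x) * (x / 2) powr \<nu>) (at x)"
    by (simp add: bessel_I_eq[abs_def])
  then show "deriv (bessel_I \<nu>) x = (x / 2) powr \<nu> / x * dbessel \<nu> (- x\<^sup>2)"
    using assms by (simp add: DERIV_imp_deriv dbessel_eq[OF nu(1)] field_simps power2_eq_square)
qed

lemma bessel_J_deriv_zeros_eq: "bessel_J_deriv_zeros \<nu> = {x. x > 0 \<and> dbessel \<nu> (x\<^sup>2) = 0}"
  unfolding bessel_J_deriv_zeros_def using deriv_bessel(1) by auto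

lemma bessel_I_deriv_zero_props:
  "bessel_I_deriv_zero \<nu> > 0" "dbessel \<nu> (- (bessel_I_deriv_zero \<nu>)\<^sup>2) = 0"
proof -
  obtain z0 where z0: "z0 < 0" "dbessel \<nu> z0 = 0" "\<And>z. z < 0 \<Longrightarrow> dbessel \<nu> z = 0 \<Longrightarrow> z = z0"
    using dbessel_neg_zero[OF nu] by blast
  have iff: "x > 0 \<and> deriv (bessel_I \<nu>) x = 0 \<longleftrightarrow> x > 0 \<and> dbessel \<nu> (- x\<^sup>2) = 0" for x
    using deriv_bessel(2)[of x] by auto
  have "bessel_I_deriv_zero \<nu> = sqrt (- z0)"
    unfolding bessel_I_deriv_zero_def iff
  proof (rule the_equality)
    show "0 < sqrt (- z0) \<and> dbessel \<nu> (- (sqrt (- z0))\<^sup>2) = 0" using z0(1,2) by simp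
    fix x assume x: "0 < x \<and> dbessel \<nu> (- x\<^sup>2) = 0"
    then have "- x\<^sup>2 = z0" using z0(3)[of "- x\<^sup>2"] by simp
    then have "- z0 = x\<^sup>2" by simp
    then show "x = sqrt (- z0)" using x by simp
  qed
  then show "bessel_I_deriv_zero \<nu> > 0" "dbessel \<nu> (- (bessel_I_deriv_zero \<nu>)\<^sup>2) = 0" using z0(1,2) by simp_all
qed

lemma bessel_J_deriv_zeros_finite_below: "finite {y \<in> bessel_J_deriv_zeros \<nu>. y \<le> x}"
proof (rule finite_imageD)
  show "inj_on (\<lambda>y. y\<^sup>2) {y \<in> bessel_J_deriv_zeros \<nu>. y \<le> x}"
    by (auto simp: inj_on_def bessel_J_deriv_zeros_eq)
  have "(\<lambda>y. y\<^sup>2) ` {y \<in> bessel_J_deriv_zeros \<nu>. y \<le> x} \<subseteq> {s \<in> {0..x\<^sup>2}. dbessel \<nu> s = 0}"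
    by (auto simp: bessel_J_deriv_zeros_eq intro: power_mono)
  then show "finite ((\<lambda>y. y\<^sup>2) ` {y \<in> bessel_J_deriv_zeros \<nu>. y \<le> x})"
    using dbessel_finite_zeros[OF nu] finite_subset by blast
qed

lemma bessel_J_deriv_zeros_infinite: "infinite (bessel_J_deriv_zeros \<nu>)"
proof
  assume fin: "finite (bessel_J_deriv_zeros \<nu>)"
  define M where "M = Max (insert 0 (bessel_J_deriv_zeros \<nu>))"
  obtain s where s: "s > M\<^sup>2" "dbessel \<nu> s = 0" using dbessel_zeros_unbounded[OF nu] by blast
  then have "s > 0" using zero_le_power2[of M] by linarith
  then have "sqrt s \<in> bessel_J_deriv_zeros \<nu>" using s by (simp add: bessel_J_deriv_zeros_eq)
  then have "sqrt s \<le> M" using fin by (simp add: M_def)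
  moreover have "sqrt s > M" using s(1) real_less_rsqrt by blast
  ultimately show False by simp
qed

end

text \<open>The rank \<open>\<kappa> x = card {y \<in> Z. y \<le> x}\<close> is injective on \<open>Z\<close>, and it maps the elements up to some
  \<open>M \<in> Z\<close> into \<open>{1..\<kappa> M}\<close>, a set of the same cardinality; so every positive rank occurs.\<close>

lemma bij_betw_enumeration:
  fixes Z :: "real set"
  assumes fin: "\<And>x. finite {y \<in> Z. y \<le> x}" and inf: "infinite Z"
  shows "bij_betw (\<lambda>k. THE x. x \<in> Z \<and> card {y \<in> Z. y \<le> x} = Suc k) UNIV Z"
proof -
  define \<kappa> where "\<kappa> = (\<lambda>x. card {y \<in> Z. y \<le> x})"
  have mono: "\<kappa> x < \<kappa> y" if "x < y" "y \<in> Z" for x y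
    unfolding \<kappa>_def using that by (intro psubset_card_mono fin) force
  have inj: "x = y" if "x \<in> Z" "y \<in> Z" "\<kappa> x = \<kappa> y" for x y
    using mono[of x y] mono[of y x] that by (cases x y rule: linorder_cases) auto
  have pos: "\<kappa> x \<ge> 1" if "x \<in> Z" for x
    unfolding \<kappa>_def using that fin[of x] by (simp add: Suc_le_eq card_gt_0_iff) auto
  have surj: "\<exists>x\<in>Z. \<kappa> x = Suc k" for k
  proof -
    obtain A where A: "A \<subseteq> Z" "finite A" "card A = Suc k"
      using infinite_arbitrarily_large[OF inf] by blast
    define M where "M = Max A"
    have M: "M \<in> A" "\<And>a. a \<in> A \<Longrightarrow> a \<le> M" using A by (auto simp: M_def intro!: Max_in)
    define W where "W = {y \<in> Z. y \<le> M}"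
    have W: "finite W" "card W = \<kappa> M" unfolding W_def \<kappa>_def using fin by auto
    have "Suc k \<le> \<kappa> M" using A M card_mono[OF W(1), of A] W(2) by (auto simp: W_def)
    have "\<kappa> ` W = {1..\<kappa> M}"
    proof (rule card_subset_eq)
      show "\<kappa> ` W \<subseteq> {1..\<kappa> M}"
      proof
        fix j assume "j \<in> \<kappa> ` W"
        then obtain x where x: "x \<in> Z" "x \<le> M" "j = \<kappa> x" by (auto simp: W_def)
        have "\<kappa> x \<le> \<kappa> M" unfolding \<kappa>_def using x by (intro card_mono fin) auto
        then show "j \<in> {1..\<kappa> M}" using pos x by auto
      qed
      have "inj_on \<kappa> W" using inj by (auto simp: inj_on_def W_def)
      then show "card (\<kappa> ` W) = card {1..\<kappa> M}" using W by (simp add: card_image)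
    qed simp
    then have "Suc k \<in> \<kappa> ` W" using \<open>Suc k \<le> \<kappa> M\<close> by auto
    then show ?thesis by (auto simp: W_def)
  qed
  define e where "e = (\<lambda>k. THE x. x \<in> Z \<and> \<kappa> x = Suc k)"
  have e: "e k \<in> Z" "\<kappa> (e k) = Suc k" for k
  proof -
    have "\<exists>!x. x \<in> Z \<and> \<kappa> x = Suc k" using surj[of k] inj by auto
    from theI'[OF this] show "e k \<in> Z" "\<kappa> (e k) = Suc k" by (auto simp: e_def)
  qed
  have "bij_betw e UNIV Z"
  proof (rule bij_betwI[where g = "\<lambda>x. \<kappa> x - 1"])
    show "e (\<kappa> x - 1) = x" if "x \<in> Z" for x
      using e[of "\<kappa> x - 1"] inj[OF _ that] pos[OF that] by auto
  qed (use e in auto)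
  then show ?thesis by (simp add: e_def \<kappa>_def)
qed

theorem mainTheorem14:
  fixes \<nu> :: real
  assumes "-1 < \<nu>" and "\<nu> < 0"
  shows "(\<lambda>k. 1 / (((bessel_J_deriv_zero \<nu> (Suc k))\<^sup>2 - \<nu>\<^sup>2) * (bessel_J_deriv_zero \<nu> (Suc k))\<^sup>2))
    sums (1 / (4 * \<nu>\<^sup>2 * (\<nu> + 1))
      - 1 / (((bessel_I_deriv_zero \<nu>)\<^sup>2 + \<nu>\<^sup>2) * (bessel_I_deriv_zero \<nu>)\<^sup>2))"
proof -
  define y where "y = bessel_I_deriv_zero \<nu>"
  define X where "X = bessel_J_deriv_zeros \<nu>"
  have y: "y > 0" "dbessel \<nu> (- y\<^sup>2) = 0"
    using bessel_I_deriv_zero_props[OF assms] by (simp_all add: y_def)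
  have X: "X = {x. x > 0 \<and> dbessel \<nu> (x\<^sup>2) = 0}"
    unfolding X_def by (rule bessel_J_deriv_zeros_eq[OF assms])
  have zeros: "{z. dbessel \<nu> z = 0} - {- y\<^sup>2} = (\<lambda>x. x\<^sup>2) ` X"
  proof
    show "(\<lambda>x. x\<^sup>2) ` X \<subseteq> {z. dbessel \<nu> z = 0} - {- y\<^sup>2}"
    proof
      fix z assume "z \<in> (\<lambda>x. x\<^sup>2) ` X"
      then obtain x where "x > 0" "dbessel \<nu> (x\<^sup>2) = 0" "z = x\<^sup>2" by (auto simp: X)
      moreover have "x\<^sup>2 > - y\<^sup>2" using \<open>x > 0\<close> y(1) by (simp add: less_trans[of _ 0])
      ultimately show "z \<in> {z. dbessel \<nu> z = 0} - {- y\<^sup>2}" by simp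
    qed
    show "{z. dbessel \<nu> z = 0} - {- y\<^sup>2} \<subseteq> (\<lambda>x. x\<^sup>2) ` X"
    proof
      fix z assume z: "z \<in> {z. dbessel \<nu> z = 0} - {- y\<^sup>2}"
      have "\<not> z < 0" using z y dbessel_neg_zero[OF assms] by (metis DiffD1 DiffD2 insertI1 mem_Collect_eq neg_less_0_iff_less zero_less_power)
      moreover have "z \<noteq> 0" using z dbessel_coeff_0_neg[OF assms] by (auto simp: dbessel_at_0)
      ultimately show "z \<in> (\<lambda>x. x\<^sup>2) ` X"
        using z by (intro image_eqI[of _ _ "sqrt z"]) (auto simp: X)
    qed
  qed
  have "(summand \<nu> has_sum (1 / (4 * \<nu>\<^sup>2 * (\<nu> + 1)) - summand \<nu> (- y\<^sup>2))) ({z. dbessel \<nu> z = 0} - {- y\<^sup>2})"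
    by (rule has_sum_Diff[OF has_sum_over_dbessel_zeros[OF assms]])
      (use y in \<open>auto intro: has_sum_finiteI\<close>)
  then have hs: "((\<lambda>x. summand \<nu> (x\<^sup>2)) has_sum (1 / (4 * \<nu>\<^sup>2 * (\<nu> + 1)) - summand \<nu> (- y\<^sup>2))) X"
    unfolding zeros by (subst (asm) has_sum_reindex) (auto simp: X inj_on_def o_def)
  have bij: "bij_betw (\<lambda>k. bessel_J_deriv_zero \<nu> (Suc k)) UNIV X"
    unfolding bessel_J_deriv_zero_def X_def
    by (intro bij_betw_enumeration bessel_J_deriv_zeros_finite_below bessel_J_deriv_zeros_infinite assms)
  have "((\<lambda>k. summand \<nu> ((bessel_J_deriv_zero \<nu> (Suc k))\<^sup>2)) has_sum
      (1 / (4 * \<nu>\<^sup>2 * (\<nu> + 1)) - summand \<nu> (- y\<^sup>2))) UNIV"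
    using has_sum_reindex_bij_betw[OF bij, of "\<lambda>x. summand \<nu> (x\<^sup>2)"] hs by simp
  moreover have "summand \<nu> (- y\<^sup>2) = 1 / ((y\<^sup>2 + \<nu>\<^sup>2) * y\<^sup>2)"
    by (simp add: summand_def algebra_simps)
  ultimately have "(\<lambda>k. summand \<nu> ((bessel_J_deriv_zero \<nu> (Suc k))\<^sup>2)) sums
      (1 / (4 * \<nu>\<^sup>2 * (\<nu> + 1)) - 1 / ((y\<^sup>2 + \<nu>\<^sup>2) * y\<^sup>2))"
    using has_sum_imp_sums by simp
  then show ?thesis by (simp only: summand_def y_def)
qed

end
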